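(* Let $E_J$ be a $W$-graph ideal for the weighted Coxeter system $(W,S,L)$, let $x,y\in E_J$ and $\gamma\in\Gamma''$. Then $$[q^\gamma](P_{x,y})=[q_x^{-1}q_yq^{-\gamma}](R_{x,y})+\sum_{r=1}^{\ell(y)-\ell(x)}\ \sum_{\varphi\in\mathscr{M}_r(x,y)}\ \sum_{(\lambda_0,\ldots,\lambda_{r+1})\in\mathscr{F}_\gamma(\varphi)}\ \prod_{i=0}^{r}\big[q_{x_{i+1}}q_y^{-1}q^{\lambda_i}q^{\lambda_{i+1}}\big](R_{x_i,x_{i+1}}),$$ where $\varphi$ denotes the multichain $x=x_0\leqslant x_1\leqslant\cdots\leqslant x_{r+1}=y$.
   Context: Setting. $(W,S)$ is a Coxeter system with length function $\ell$ and Bruhat order $\leqslant$; $\epsilon_w=(-1)^{\ell(w)}$. $\Gamma$ is a totally ordered abelian group (written additively). $\mathbb{Z}[\Gamma]$ is its group ring with $\mathbb{Z}$-basis $\{q^\gamma\mid\gamma\in\Gamma\}$, $q^\gamma q^\zeta=q^{\gamma+\zeta}$; $[q^\gamma](f)$ is the coefficient of $q^\gamma$ in $f$; $\mathsf{deg}(f)$ is the largest $\gamma$ with $[q^\gamma](f)\neq0$, $\mathsf{deg}(0)=-\infty$. The bar is the ring automorphism $q^\gamma\mapsto q^{-\gamma}$. $L:W\to\Gamma$ is a weight: $L(w)=L(s_1)+\cdots+L(s_k)$ for every reduced word $w=s_1\cdots s_k$, and $L(s)\geqslant0$ for all $s\in S$. Put $q_w=q^{L(w)}$; thus e.g. $[q_x^{-1}q_yq^{-\gamma}]$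 means the coefficient of $q^{L(y)-L(x)-\gamma}$. $\Gamma''=\{\sum n_iL(s_i)\mid s_i\in S,n_i\in\mathbb{Z}\}$ (finite sums). $\mathscr{H}$ is the Hecke algebra over $\mathbb{Z}[\Gamma]$ with basis $\{T_w\}_{w\in W}$, $T_sT_w=T_{sw}$ if $\ell(sw)>\ell(w)$, $T_sT_w=q_sT_{sw}+(q_s-1)T_w$ if $\ell(sw)<\ell(w)$, with bar involution (semilinear ring involution) $\overline{T_s}=q_s^{-1}T_s+(q_s^{-1}-1)$. $W$-graph ideal. $x$ is a suffix of $y$ ($x\leqslant_L y$) if $y=zx$ with $\ell(y)=\ell(z)+\ell(x)$. Let $E\subseteq W$ be an ideal of $(W,\leqslant_L)$, i.e. every suffix of an element of $E$ is in $E$. For $J\subseteq S$, $D_J=\{w\mid\ell(ws)>\ell(w)\ \forall s\in J\}$. Let $J\subseteq\{s\in S\mid\ell(xs)>\ell(x)\ \forall x\in E\}$, so $E\subseteq D_J$; write $E_J$ for $E$ with this $J$. For $y\in E_J$: $SD(y)=\{s\mid\ell(sy)<\ell(y)\}$, $SA(y)=\{s\mid\ell(sy)>\ell(y),sy\in E_J\}$, $WD(y)=\{s\mid\ell(sy)>\ell(y),sy\notin D_J\}$, $WA(y)=\{s\mid\ell(sy)>\ell(y),sy\in D_J\setminus E_J\}$. $E_J$ is a $W$-graph ideal if there is an $\mathscr{H}$-module $M(E_J,L)$, free over $\mathbb{Z}[\Gamma]$ with basis $\{\Gamma_y\mid y\in E_J\}$, such that $T_s\Gamma_y$ equals $q_s\Gamma_{sy}+(q_s-1)\Gamma_y$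 if $s\in SD(y)$; $\Gamma_{sy}$ if $s\in SA(y)$; $-\Gamma_y$ if $s\in WD(y)$; $q_s\Gamma_y-\sum_{z<sy,\,z\in E_J}r^s_{z,y}\Gamma_z$ if $s\in WA(y)$, for some $r^s_{z,y}\in q_s\mathbb{Z}[\Gamma]$; and $M(E_J,L)$ admits a $\mathbb{Z}[\Gamma]$-semilinear involution $m\mapsto\overline m$ with $\overline{\Gamma_1}=\Gamma_1$ and $\overline{T_w\Gamma_y}=\overline{T_w}\,\overline{\Gamma_y}$ for all $w\in W,y\in E_J$. Fix such a module. $R$-polynomials. $R_{x,y}\in\mathbb{Z}[\Gamma]$ ($x,y\in E_J$) are defined by $\overline{\Gamma_y}=\sum_{x\in E_J}\epsilon_x\epsilon_yq_y^{-1}R_{x,y}\Gamma_x$. Standing facts: $R_{x,y}=0$ if $x\not\leqslant y$, $R_{x,x}=1$, and for $x\leqslant y$ all exponents $\gamma$ occurring in $R_{x,y}$ lie in $\Gamma''$ and satisfy $0\leqslant\gamma\leqslant L(y)-L(x)$. Kazhdan–Lusztig polynomials. $P_{x,y}\in\mathbb{Z}[\Gamma]$ ($x,y\in E_J$) is the unique family with $P_{x,y}=0$ if $x\not\leqslant y$, $P_{x,x}=1$, $\mathsf{deg}(P_{x,y})<\frac{L(y)-L(x)}2$ for $x<y$ (i.e. $2\,\mathsf{deg}(P_{x,y})<L(y)-L(x)$), and $q_x^{-1}q_y\overline{P_{x,y}}=\sum_{x\leqslant t\leqslant y,\,t\in E_J}R_{x,t}P_{t,y}$. Multichains. $\mathscr{M}_r(x,y)$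 is the set of multichains $x=x_0\leqslant x_1\leqslant\cdots\leqslant x_{r+1}=y$ with all $x_i\in E_J$ (Bruhat order). Index sets. For $\varphi\in\mathscr{M}_r(x,y)$, $\mathscr{F}_\gamma(\varphi)$ is the set of $(a_0,a_1,\ldots,a_{r+1})\in(\Gamma'')^{r+2}$ such that $a_0=L(y)-L(x)-\gamma$; $\gamma\geqslant a_1>a_2>\cdots>a_r>a_{r+1}=0$; and $a_i>L(y)-L(x_i)-a_i\geqslant a_{i+1}$ for $i\in\{1,\ldots,r\}$. *)

theory Defs
  imports
    "HOL-Algebra.Multiplicative_Group"
    "HOL-Library.Poly_Mapping"
    "HOL-Library.Extended"
begin

section \<open>The group ring of a totally ordered abelian group\<close>

text \<open>
  The group ring over the integers of a totally ordered abelian group \<open>'g\<close> is the type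
  \<open>'g \<Rightarrow>\<^sub>0 int\<close> with its convolution product; the coefficient of \<open>q\<^sup>\<gamma>\<close> in \<open>f\<close> is
  \<open>Poly_Mapping.lookup f \<gamma>\<close>.
\<close>

type_synonym 'g group_ring = "'g \<Rightarrow>\<^sub>0 int"

definition q_pow :: "'g::linordered_ab_group_add \<Rightarrow> 'g group_ring" where
  "q_pow \<gamma> = Poly_Mapping.single \<gamma> 1"

definition bar :: "'g::linordered_ab_group_add group_ring \<Rightarrow> 'g group_ring" where
  "bar f = Poly_Mapping.map_key uminus f"

lemma lookup_bar: "Poly_Mapping.lookup (bar f) \<gamma> = Poly_Mapping.lookup f (- \<gamma>)"
  unfolding bar_def by (subst Poly_Mapping.map_key.rep_eq) auto

definition deg :: "'g::linordered_ab_group_add group_ring \<Rightarrow> 'g extended" where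
  "deg f = (if f = 0 then -\<infinity> else Fin (Max (Poly_Mapping.keys f)))"

definition int_mult :: "int \<Rightarrow> 'g::linordered_ab_group_add \<Rightarrow> 'g" where
  "int_mult n \<gamma> = (if 0 \<le> n then (\<Sum>i<nat n. \<gamma>) else - (\<Sum>i<nat (- n). \<gamma>))"

section \<open>Coxeter systems\<close>

definition word_prod :: "('w, 'b) monoid_scheme \<Rightarrow> 'w list \<Rightarrow> 'w" where
  "word_prod W u = foldr (\<lambda>s w. s \<otimes>\<^bsub>W\<^esub> w) u \<one>\<^bsub>W\<^esub>"

text \<open>
  The congruence on the free monoid of words in \<open>S\<close> generated by the relations
  \<open>(st)\<^bsup>m(s,t)\<^esup> = 1\<close>, where \<open>m(s,t)\<close> is the order of \<open>st\<close> in \<open>W\<close>.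
  Since \<open>group.ord\<close> is 0 for elements of infinite order, there is no relation in that case.
  For involutions \<open>s = t\<close> it contains \<open>s s = 1\<close>, so that the quotient of the free monoid
  is the group presented by these relations.
\<close>

inductive coxeter_cong :: "('w, 'b) monoid_scheme \<Rightarrow> 'w set \<Rightarrow> 'w list \<Rightarrow> 'w list \<Rightarrow> bool"
  for W :: "('w, 'b) monoid_scheme" and S :: "'w set" where
  relation: "s \<in> S \<Longrightarrow> t \<in> S \<Longrightarrow>
    coxeter_cong W S (concat (replicate (group.ord W (s \<otimes>\<^bsub>W\<^esub> t)) [s, t])) []"
| cong_refl: "u \<in> lists S \<Longrightarrow> coxeter_cong W S u u"
| cong_sym: "coxeter_cong W S u v \<Longrightarrow> coxeter_cong W S v u"
| cong_trans: "coxeter_cong W S u v \<Longrightarrow> coxeter_cong W S v w \<Longrightarrow> coxeter_cong W S u w"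
| cong_append: "coxeter_cong W S u v \<Longrightarrow> a \<in> lists S \<Longrightarrow> b \<in> lists S \<Longrightarrow>
    coxeter_cong W S (a @ u @ b) (a @ v @ b)"

text \<open>
  \<open>W\<close> is the group generated by the set \<open>S\<close> of involutions subject to the relations
  \<open>(st)\<^bsup>m(s,t)\<^esup> = 1\<close> for all \<open>s, t\<close> in \<open>S\<close> with \<open>m(s,t)\<close> finite. \<open>S\<close> may be infinite.
\<close>

locale coxeter_system = group W
  for W :: "('w, 'b) monoid_scheme" (structure) and S :: "'w set" +
  assumes gens_closed: "S \<subseteq> carrier W"
    and gens_generate: "generate W S = carrier W"
    and gens_involution: "s \<in> S \<Longrightarrow> s \<noteq> \<one> \<and> s \<otimes> s = \<one>"
    and presentation: "u \<in> lists S \<Longrightarrow> v \<in> lists S \<Longrightarrow>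
      word_prod W u = word_prod W v \<longleftrightarrow> coxeter_cong W S u v"
begin

definition len :: "'w \<Rightarrow> nat" where
  "len w = (LEAST n. \<exists>u \<in> lists S. length u = n \<and> word_prod W u = w)"

definition reduced :: "'w list \<Rightarrow> bool" where
  "reduced u \<longleftrightarrow> u \<in> lists S \<and> length u = len (word_prod W u)"

definition sgn_len :: "'w \<Rightarrow> 'g::linordered_ab_group_add group_ring" where
  "sgn_len w = (- 1) ^ len w"

definition reflections :: "'w set" where
  "reflections = {w \<otimes> s \<otimes> inv w | w s. w \<in> carrier W \<and> s \<in> S}"

definition bruhat_step :: "'w \<Rightarrow> 'w \<Rightarrow> bool" where
  "bruhat_step u v \<longleftrightarrow> u \<in> carrier W \<and> (\<exists>t \<in> reflections. v = u \<otimes> t) \<and> len u < len v"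

definition bruhat_le :: "'w \<Rightarrow> 'w \<Rightarrow> bool" where
  "bruhat_le = bruhat_step\<^sup>*\<^sup>*"

definition bruhat_less :: "'w \<Rightarrow> 'w \<Rightarrow> bool" where
  "bruhat_less x y \<longleftrightarrow> bruhat_le x y \<and> x \<noteq> y"

definition is_suffix :: "'w \<Rightarrow> 'w \<Rightarrow> bool" where
  "is_suffix x y \<longleftrightarrow> x \<in> carrier W \<and> y \<in> carrier W \<and>
     (\<exists>z \<in> carrier W. y = z \<otimes> x \<and> len y = len z + len x)"

definition D :: "'w set \<Rightarrow> 'w set" where
  "D J = {w \<in> carrier W. \<forall>s \<in> J. len (w \<otimes> s) > len w}"

definition SD :: "'w \<Rightarrow> 'w set" where
  "SD y = {s \<in> S. len (s \<otimes> y) < len y}"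

definition SA :: "'w set \<Rightarrow> 'w \<Rightarrow> 'w set" where
  "SA E y = {s \<in> S. len (s \<otimes> y) > len y \<and> s \<otimes> y \<in> E}"

definition WD :: "'w set \<Rightarrow> 'w \<Rightarrow> 'w set" where
  "WD J y = {s \<in> S. len (s \<otimes> y) > len y \<and> s \<otimes> y \<notin> D J}"

definition WA :: "'w set \<Rightarrow> 'w set \<Rightarrow> 'w \<Rightarrow> 'w set" where
  "WA E J y = {s \<in> S. len (s \<otimes> y) > len y \<and> s \<otimes> y \<in> D J - E}"

definition multichains :: "'w set \<Rightarrow> nat \<Rightarrow> 'w \<Rightarrow> 'w \<Rightarrow> 'w list set" where
  "multichains E r x y = {xs. length xs = r + 2 \<and> set xs \<subseteq> E \<and> xs ! 0 = x \<and> xs ! (r + 1) = y \<and>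
     (\<forall>i \<le> r. bruhat_le (xs ! i) (xs ! (i + 1)))}"

end

locale weighted_coxeter_system = coxeter_system W S
  for W :: "('w, 'b) monoid_scheme" (structure) and S :: "'w set" +
  fixes L :: "'w \<Rightarrow> 'g::linordered_ab_group_add"
  assumes weight_reduced: "reduced u \<Longrightarrow> L (word_prod W u) = sum_list (map L u)"
    and weight_nonneg: "s \<in> S \<Longrightarrow> 0 \<le> L s"
begin

definition weight_group :: "'g set" where
  "weight_group = {(\<Sum>s\<in>F. int_mult (n s) (L s)) | F n. finite F \<and> F \<subseteq> S}"

text \<open>The index set \<open>\<F>\<^sub>\<gamma>(\<phi>)\<close> of a multichain \<open>\<phi> = xs\<close> of length \<open>r + 2\<close>; it can be infinite.\<close>

definition index_set :: "'g \<Rightarrow> nat \<Rightarrow> 'w list \<Rightarrow> 'g list set" where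
  "index_set \<gamma> r xs = {a. length a = r + 2 \<and> set a \<subseteq> weight_group \<and>
     a ! 0 = L (xs ! (r + 1)) - L (xs ! 0) - \<gamma> \<and>
     a ! 1 \<le> \<gamma> \<and> (\<forall>i \<in> {1..r}. a ! i > a ! (i + 1)) \<and> a ! (r + 1) = 0 \<and>
     (\<forall>i \<in> {1..r}. a ! i > L (xs ! (r + 1)) - L (xs ! i) - a ! i \<and>
        L (xs ! (r + 1)) - L (xs ! i) - a ! i \<ge> a ! (i + 1))}"

text \<open>
  Only finitely many members of the index set give a nonzero product, since each entry determines
  the next one up to finitely many choices; so \<open>Sum_any\<close> yields the intended sum over it.
\<close>

lemma finite_index_support:
  fixes R :: "'w \<Rightarrow> 'w \<Rightarrow> 'g group_ring"
  shows "finite {a \<in> index_set \<gamma> r xs.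
    (\<Prod>i \<le> r. Poly_Mapping.lookup (R (xs ! i) (xs ! (i + 1)))
       (L (xs ! (i + 1)) - L y + a ! i + a ! (i + 1))) \<noteq> 0}"
proof -
  define A where "A = (\<lambda>k. {a :: 'g list. length a = k + 1 \<and>
      a ! 0 = L (xs ! (r + 1)) - L (xs ! 0) - \<gamma> \<and>
      (\<forall>i<k. L (xs ! (i + 1)) - L y + a ! i + a ! (i + 1)
         \<in> Poly_Mapping.keys (R (xs ! i) (xs ! (i + 1))))})"
  have "finite (A k)" for k
  proof (induction k)
    case 0
    have "A 0 \<subseteq> {[L (xs ! (r + 1)) - L (xs ! 0) - \<gamma>]}"
      by (auto simp: A_def length_Suc_conv)
    then show ?case
      by (rule finite_subset) simp
  next
    case (Suc k)
    have "A (Suc k) \<subseteq> (\<lambda>(a, e). a @ [e - (L (xs ! (k + 1)) - L y + a ! k)]) `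
        (A k \<times> Poly_Mapping.keys (R (xs ! k) (xs ! (k + 1))))" (is "_ \<subseteq> ?f ` ?B")
    proof
      fix a assume a: "a \<in> A (Suc k)"
      let ?e = "L (xs ! (k + 1)) - L y + a ! k + a ! (k + 1)"
      have len: "length a = Suc (Suc k)"
        using a by (simp add: A_def)
      have "butlast a \<in> A k"
        using a by (auto simp: A_def nth_butlast)
      moreover have "?e \<in> Poly_Mapping.keys (R (xs ! k) (xs ! (k + 1)))"
        using a by (auto simp: A_def)
      moreover have "a = ?f (butlast a, ?e)"
      proof -
        have "last a = a ! (k + 1)"
          using len by (cases "a = []") (auto simp: last_conv_nth)
        moreover have "a = butlast a @ [last a]"
          using len by (cases "a = []") auto
        ultimately show ?thesis
          using len by (simp add: nth_butlast)
      qed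
      ultimately show "a \<in> ?f ` ?B"
        by blast
    qed
    then show ?case
      using Suc.IH by (auto intro: finite_subset)
  qed
  then have "finite (A (r + 1))" .
  then show ?thesis
    by (rule rev_finite_subset)
      (auto simp: index_set_def A_def in_keys_iff less_Suc_eq_le simp del: not_less)
qed

end

section \<open>The Hecke algebra\<close>

locale hecke_algebra = weighted_coxeter_system W S L + H: Modules.module scaleH
  for W :: "('w, 'b) monoid_scheme" (structure) and S :: "'w set"
    and L :: "'w \<Rightarrow> 'g::linordered_ab_group_add"
    and scaleH :: "'g group_ring \<Rightarrow> 'h::ring_1 \<Rightarrow> 'h" +
  fixes T :: "'w \<Rightarrow> 'h" and barH :: "'h \<Rightarrow> 'h"
  assumes scaleH_mult_left: "scaleH a h * k = scaleH a (h * k)"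
    and scaleH_mult_right: "h * scaleH a k = scaleH a (h * k)"
    and T_inj: "inj_on T (carrier W)"
    and T_independent: "\<not> H.dependent (T ` carrier W)"
    and T_span: "H.span (T ` carrier W) = UNIV"
    and T_one: "T \<one> = 1"
    and T_mult_up: "s \<in> S \<Longrightarrow> w \<in> carrier W \<Longrightarrow> len (s \<otimes> w) > len w \<Longrightarrow>
      T s * T w = T (s \<otimes> w)"
    and T_mult_down: "s \<in> S \<Longrightarrow> w \<in> carrier W \<Longrightarrow> len (s \<otimes> w) < len w \<Longrightarrow>
      T s * T w = scaleH (q_pow (L s)) (T (s \<otimes> w)) + scaleH (q_pow (L s) - 1) (T w)"
    and barH_add: "barH (h + k) = barH h + barH k"
    and barH_mult: "barH (h * k) = barH h * barH k"
    and barH_one: "barH 1 = 1"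
    and barH_scale: "barH (scaleH a h) = scaleH (bar a) (barH h)"
    and barH_barH: "barH (barH h) = h"
    and barH_T: "s \<in> S \<Longrightarrow>
      barH (T s) = scaleH (q_pow (- L s)) (T s) + scaleH (q_pow (- L s) - 1) 1"

section \<open>\<open>W\<close>-graph ideals\<close>

text \<open>
  The data witnessing that \<open>E\<close>, with the chosen \<open>J\<close>, is a \<open>W\<close>-graph ideal: an
  \<open>\<H>\<close>-module with basis \<open>Gam y\<close> (\<open>y \<in> E\<close>) and bar involution \<open>barM\<close>.
  The condition \<open>r z \<in> q\<^sub>s \<int>[\<Gamma>]\<close> is expressed by divisibility; as \<open>q\<^sub>s\<close> is a
  unit it does not restrict \<open>r\<close>.
\<close>

locale w_graph_ideal =
  hecke_algebra W S L scaleH T barH + M: Modules.module scaleM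
  for W :: "('w, 'b) monoid_scheme" (structure) and S :: "'w set"
    and L :: "'w \<Rightarrow> 'g::linordered_ab_group_add"
    and scaleH :: "'g group_ring \<Rightarrow> 'h::ring_1 \<Rightarrow> 'h"
    and T :: "'w \<Rightarrow> 'h" and barH :: "'h \<Rightarrow> 'h"
    and scaleM :: "'g group_ring \<Rightarrow> 'm::ab_group_add \<Rightarrow> 'm" +
  fixes E J :: "'w set"
    and act :: "'h \<Rightarrow> 'm \<Rightarrow> 'm" and Gam :: "'w \<Rightarrow> 'm" and barM :: "'m \<Rightarrow> 'm"
  assumes E_closed: "E \<subseteq> carrier W"
    and E_ideal: "y \<in> E \<Longrightarrow> is_suffix x y \<Longrightarrow> x \<in> E"
    and J_sub: "J \<subseteq> {s \<in> S. \<forall>x \<in> E. len (x \<otimes> s) > len x}"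
    and act_add_left: "act (h + k) m = act h m + act k m"
    and act_add_right: "act h (m + n) = act h m + act h n"
    and act_mult: "act (h * k) m = act h (act k m)"
    and act_one: "act 1 m = m"
    and act_scale_left: "act (scaleH a h) m = scaleM a (act h m)"
    and act_scale_right: "act h (scaleM a m) = scaleM a (act h m)"
    and Gam_inj: "inj_on Gam E"
    and Gam_independent: "\<not> M.dependent (Gam ` E)"
    and Gam_span: "M.span (Gam ` E) = UNIV"
    and act_SD: "y \<in> E \<Longrightarrow> s \<in> SD y \<Longrightarrow>
      act (T s) (Gam y) = scaleM (q_pow (L s)) (Gam (s \<otimes> y)) + scaleM (q_pow (L s) - 1) (Gam y)"
    and act_SA: "y \<in> E \<Longrightarrow> s \<in> SA E y \<Longrightarrow> act (T s) (Gam y) = Gam (s \<otimes> y)"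
    and act_WD: "y \<in> E \<Longrightarrow> s \<in> WD J y \<Longrightarrow> act (T s) (Gam y) = - Gam y"
    and act_WA: "y \<in> E \<Longrightarrow> s \<in> WA E J y \<Longrightarrow>
      \<exists>r. (\<forall>z. q_pow (L s) dvd r z) \<and>
        act (T s) (Gam y) = scaleM (q_pow (L s)) (Gam y) -
          (\<Sum>z \<in> {z \<in> E. bruhat_less z (s \<otimes> y)}. scaleM (r z) (Gam z))"
    and barM_add: "barM (m + n) = barM m + barM n"
    and barM_scale: "barM (scaleM a m) = scaleM (bar a) (barM m)"
    and barM_barM: "barM (barM m) = m"
    and barM_Gam_one: "barM (Gam \<one>) = Gam \<one>"
    and barM_act: "w \<in> carrier W \<Longrightarrow> y \<in> E \<Longrightarrow>
      barM (act (T w) (Gam y)) = act (barH (T w)) (barM (Gam y))"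
begin

text \<open>
  The defining expansion of the \<open>R\<close>-polynomials. As \<open>Gam\<close> is a basis, this determines
  \<open>R x y\<close> for all \<open>x, y \<in> E\<close>; the sum runs over the finite support.
\<close>

definition is_R_family :: "('w \<Rightarrow> 'w \<Rightarrow> 'g group_ring) \<Rightarrow> bool" where
  "is_R_family R \<longleftrightarrow> (\<forall>y \<in> E. finite {x \<in> E. R x y \<noteq> 0} \<and>
     barM (Gam y) = (\<Sum>x \<in> {x \<in> E. R x y \<noteq> 0}.
       scaleM (sgn_len x * sgn_len y * q_pow (- L y) * R x y) (Gam x)))"

definition is_KL_family ::
    "('w \<Rightarrow> 'w \<Rightarrow> 'g group_ring) \<Rightarrow> ('w \<Rightarrow> 'w \<Rightarrow> 'g group_ring) \<Rightarrow> bool" where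
  "is_KL_family R P \<longleftrightarrow> (\<forall>x \<in> E. \<forall>y \<in> E.
     (\<not> bruhat_le x y \<longrightarrow> P x y = 0) \<and>
     P x x = 1 \<and>
     (bruhat_less x y \<longrightarrow> deg (P x y) + deg (P x y) < Fin (L y - L x)) \<and>
     q_pow (- L x) * q_pow (L y) * bar (P x y) =
       (\<Sum>t \<in> {t \<in> E. bruhat_le x t \<and> bruhat_le t y}. R x t * P t y))"

end

end

theory Submission
  imports Defs
begin

text \<open>
  Comparing coefficients of \<open>q\<^bsup>L y - L x - \<gamma>\<^esup>\<close> in the identity defining \<open>P\<^sub>x\<^sub>,\<^sub>y\<close>, and setting
  \<open>a = L y - L t - \<zeta>\<close>, expresses \<open>[q\<^sup>\<gamma>] P\<^sub>x\<^sub>,\<^sub>y\<close> through the numbers \<open>[q\<^sup>\<zeta>] P\<^sub>t\<^sub>,\<^sub>y\<close> with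
  \<open>x \<le> t < y\<close>. The degree bound on \<open>P\<^sub>t\<^sub>,\<^sub>y\<close> forces \<open>a > \<zeta>\<close>, and the bound on the exponents of
  \<open>R\<^sub>x\<^sub>,\<^sub>t\<close> forces \<open>a \<le> \<gamma>\<close>; these are the inequalities of the index sets. The contributions of
  multichains of each length obey the same recursion, so it suffices to iterate. The term \<open>t = x\<close>
  occurs only if \<open>2\<gamma> > L y - L x\<close>, hence at most once, after which \<open>t\<close> strictly increases; this
  bounds the number of steps by \<open>len y - len x\<close>.

  If \<open>x \<le> y\<close> fails, one needs \<open>R\<^sub>x\<^sub>,\<^sub>y = 0\<close>. Writing \<open>\<Gamma>\<^sub>s\<^sub>w = T\<^sub>s \<Gamma>\<^sub>w\<close>, this follows by
  induction from the lifting property of the Bruhat order, which rests on the strong exchange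
  condition.
\<close>

section \<open>The strong exchange condition and the Bruhat order\<close>

context coxeter_system
begin

section \<open>Words in the generators, length and reflections\<close>

lemma word_prod_Nil [simp]: "word_prod W [] = \<one>"
  and word_prod_Cons [simp]: "word_prod W (s # u) = s \<otimes> word_prod W u"
  by (simp_all add: word_prod_def)

lemma gen_closed [simp, intro]: "s \<in> S \<Longrightarrow> s \<in> carrier W"
  using gens_closed by auto

lemma gen_square [simp]: "s \<in> S \<Longrightarrow> s \<otimes> s = \<one>"
  using gens_involution by auto

lemma gen_inv [simp]: "s \<in> S \<Longrightarrow> inv s = s"
  by (simp add: inv_equality)

lemma gen_cancel [simp]: "s \<in> S \<Longrightarrow> g \<in> carrier W \<Longrightarrow> s \<otimes> (s \<otimes> g) = g"
  by (simp add: m_assoc [symmetric])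

lemma inv_cancel_left [simp]:
  "g \<in> carrier W \<Longrightarrow> h \<in> carrier W \<Longrightarrow> inv g \<otimes> (g \<otimes> h) = h"
  "g \<in> carrier W \<Longrightarrow> h \<in> carrier W \<Longrightarrow> g \<otimes> (inv g \<otimes> h) = h"
  by (simp_all add: m_assoc [symmetric])

lemma word_prod_closed [simp, intro]: "u \<in> lists S \<Longrightarrow> word_prod W u \<in> carrier W"
  by (induction u) auto

lemma word_prod_append [simp]:
  "u \<in> lists S \<Longrightarrow> v \<in> lists S \<Longrightarrow> word_prod W (u @ v) = word_prod W u \<otimes> word_prod W v"
  by (induction u) (auto simp: m_assoc)

lemma word_prod_rev: "u \<in> lists S \<Longrightarrow> word_prod W (rev u) = inv (word_prod W u)"
  by (induction u) (auto simp: inv_mult_group in_lists_conv_set)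

lemma ex_word:
  assumes "w \<in> carrier W"
  obtains u where "u \<in> lists S" "word_prod W u = w"
proof -
  have "w \<in> generate W S"
    using assms gens_generate by simp
  then have "\<exists>u \<in> lists S. word_prod W u = w"
  proof induction
    case one
    show ?case by (rule bexI [of _ "[]"]) auto
  next
    case (incl h)
    then show ?case by (intro bexI [of _ "[h]"]) auto
  next
    case (inv h)
    then show ?case by (intro bexI [of _ "[h]"]) auto
  next
    case (eng g h)
    then show ?case by (metis append_in_lists_conv word_prod_append)
  qed
  then show ?thesis using that by auto
qed

lemma len_le: "u \<in> lists S \<Longrightarrow> len (word_prod W u) \<le> length u"
  unfolding len_def by (rule Least_le) auto

lemma ex_reduced:
  assumes "w \<in> carrier W"
  obtains u where "u \<in> lists S" "word_prod W u = w" "length u = len w" "reduced u"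
proof -
  from ex_word [OF assms] obtain v where "v \<in> lists S" "word_prod W v = w" .
  then have "\<exists>n. \<exists>u \<in> lists S. length u = n \<and> word_prod W u = w" by auto
  then have "\<exists>u \<in> lists S. length u = len w \<and> word_prod W u = w"
    unfolding len_def by (rule LeastI_ex)
  then show ?thesis using that by (auto simp: reduced_def)
qed

lemma reflection_closed [intro]: "t \<in> reflections \<Longrightarrow> t \<in> carrier W"
  by (auto simp: reflections_def)

lemma reflection_square:
  assumes "t \<in> reflections"
  shows "t \<otimes> t = \<one>"
proof -
  obtain w s where [simp]: "w \<in> carrier W" "s \<in> S" and t: "t = w \<otimes> s \<otimes> inv w"
    using assms by (auto simp: reflections_def)
  have "t \<otimes> t = w \<otimes> (s \<otimes> (inv w \<otimes> (w \<otimes> (s \<otimes> inv w))))"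
    by (simp add: t m_assoc)
  also have "\<dots> = \<one>"
    by (simp add: m_assoc [symmetric, of "inv w" w])
  finally show ?thesis .
qed

lemma reflection_conj:
  assumes "t \<in> reflections" "g \<in> carrier W"
  shows "g \<otimes> t \<otimes> inv g \<in> reflections"
proof -
  obtain w s where [simp]: "w \<in> carrier W" "s \<in> S" and t: "t = w \<otimes> s \<otimes> inv w"
    using assms by (auto simp: reflections_def)
  have "g \<otimes> t \<otimes> inv g = (g \<otimes> w) \<otimes> s \<otimes> inv (g \<otimes> w)"
    using assms(2) by (simp add: t m_assoc inv_mult_group)
  moreover have "g \<otimes> w \<in> carrier W"
    using assms(2) by simp
  ultimately show ?thesis
    unfolding reflections_def using \<open>s \<in> S\<close> by blast
qed

lemma gen_reflection: "s \<in> S \<Longrightarrow> s \<in> reflections"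
  by (auto simp: reflections_def intro!: exI [of _ \<one>] exI [of _ s])

text \<open>
  Whether \<open>t\<close> occurs an odd number of times among the elements
  \<open>s\<^sub>1 \<cdots> s\<^sub>i \<cdots> s\<^sub>1\<close> attached to the prefixes of the word \<open>s\<^sub>1 \<cdots> s\<^sub>k\<close>.
\<close>

fun odd_refl :: "'w list \<Rightarrow> 'w \<Rightarrow> bool" where
  "odd_refl [] t = False"
| "odd_refl (s # u) t = ((t = s) \<noteq> odd_refl u (s \<otimes> t \<otimes> s))"

text \<open>For a prefix \<open>p\<close> of \<open>v\<close>, the reflection attached to
  \<open>u @ p\<close> is the one attached to \<open>p\<close>, conjugated by the value of
  \<open>u\<close>; the lookup in \<open>v\<close> undoes this conjugation.\<close>

lemma odd_refl_append:
  "u \<in> lists S \<Longrightarrow> v \<in> lists S \<Longrightarrow> t \<in> carrier W \<Longrightarrow>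
    odd_refl (u @ v) t = (odd_refl u t \<noteq> odd_refl v (inv (word_prod W u) \<otimes> t \<otimes> word_prod W u))"
  by (induction u arbitrary: t) (auto simp: inv_mult_group m_assoc)

section \<open>Invariance of the reflection parity under the Coxeter relations\<close>

lemma concat_replicate_lists: "s \<in> S \<Longrightarrow> t \<in> S \<Longrightarrow> concat (replicate n [s, t]) \<in> lists S"
  by (induction n) auto

lemma coxeter_cong_lists: "coxeter_cong W S u v \<Longrightarrow> u \<in> lists S \<and> v \<in> lists S"
  by (induction rule: coxeter_cong.induct) (auto dest: concat_replicate_lists simp: in_lists_conv_set)

text \<open>The reflection attached to the prefix of length \<open>j + 1\<close> of the alternating
  word \<open>s t s t ...\<close> is the palindrome \<open>(st)^j s\<close>, so the parity counts
  the exponents \<open>j\<close> that yield \<open>r\<close>.\<close>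

lemma odd_refl_power:
  assumes [simp]: "s \<in> S" "t \<in> S" "r \<in> carrier W"
  shows "odd_refl (concat (replicate k [s, t])) r =
    odd (\<Sum>j<2 * k. if r = (s \<otimes> t) [^] j \<otimes> s then 1 else 0 :: nat)"
proof (induction k)
  case (Suc k)
  define c where "c = s \<otimes> t"
  define g where "g = c [^] k"
  have [simp]: "c \<in> carrier W" "g \<in> carrier W" by (simp_all add: c_def g_def)
  have words: "concat (replicate n [s, t]) \<in> lists S" for n
    by (simp add: concat_replicate_lists)
  have prod: "word_prod W (concat (replicate n [s, t])) = c [^] n" for n
  proof (induction n)
    case (Suc n)
    have "word_prod W (concat (replicate (Suc n) [s, t])) = c \<otimes> c [^] n"
      using Suc.IH by (simp add: c_def m_assoc)
    also have "\<dots> = c [^] Suc n"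
      by (rule nat_pow_Suc2 [symmetric]) simp
    finally show ?case .
  qed auto
  have snoc: "concat (replicate (Suc k) [s, t]) = concat (replicate k [s, t]) @ [s, t]"
    by (induction k) auto
  \<comment> \<open>Conjugation by \<open>s\<close> inverts \<open>c\<close>; this turns the
    conjugates of \<open>s\<close> and \<open>sts\<close> by \<open>g\<close> into powers of
    \<open>c\<close> followed by \<open>s\<close>.\<close>
  have sg: "s \<otimes> inv g = g \<otimes> s"
  proof -
    have "s \<otimes> inv (c [^] n) = c [^] n \<otimes> s" for n :: nat
    proof (induction n)
      case (Suc n)
      have "s \<otimes> inv (c [^] Suc n) = s \<otimes> (t \<otimes> (s \<otimes> inv (c [^] n)))"
        by (simp add: c_def inv_mult_group m_assoc)
      also have "\<dots> = c \<otimes> (c [^] n \<otimes> s)"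
        by (subst Suc.IH) (simp add: c_def m_assoc)
      also have "\<dots> = c [^] Suc n \<otimes> s"
        by (simp only: nat_pow_Suc2 [OF \<open>c \<in> carrier W\<close>]) (simp add: m_assoc)
      finally show ?case .
    qed simp
    then show ?thesis by (simp add: g_def)
  qed
  have g2: "c [^] (2 * k) = g \<otimes> g"
    by (simp add: g_def nat_pow_mult mult_2)
  have conj: "inv g \<otimes> r \<otimes> g = a \<longleftrightarrow> r = g \<otimes> a \<otimes> inv g" if "a \<in> carrier W" for a
    using that by (metis \<open>g \<in> carrier W\<close> assms(3) inv_closed inv_solve_left inv_solve_right m_assoc m_closed)
  have "inv g \<otimes> r \<otimes> g = s \<longleftrightarrow> r = c [^] (2 * k) \<otimes> s"
    by (subst conj) (simp_all add: g2 m_assoc sg)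
  moreover have "s \<otimes> (inv g \<otimes> r \<otimes> g) \<otimes> s = t \<longleftrightarrow> r = c [^] Suc (2 * k) \<otimes> s"
  proof -
    have "s \<otimes> (inv g \<otimes> r \<otimes> g) \<otimes> s = t \<longleftrightarrow> inv g \<otimes> r \<otimes> g = s \<otimes> t \<otimes> s"
      by (smt (verit) assms conj gen_closed gen_inv inv_closed inv_solve_left inv_solve_right m_assoc m_closed \<open>g \<in> carrier W\<close>)
    also have "\<dots> \<longleftrightarrow> r = g \<otimes> (s \<otimes> t \<otimes> s) \<otimes> inv g"
      by (rule conj) simp
    also have "g \<otimes> (s \<otimes> t \<otimes> s) \<otimes> inv g = g \<otimes> c \<otimes> (s \<otimes> inv g)"
      by (simp add: c_def m_assoc)
    also have "\<dots> = g \<otimes> c \<otimes> g \<otimes> s"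
      by (simp add: sg m_assoc)
    also have "g \<otimes> c \<otimes> g = c [^] Suc (2 * k)"
    proof -
      have "g \<otimes> c \<otimes> g = c [^] Suc k \<otimes> c [^] k"
        by (simp add: g_def)
      also have "\<dots> = c [^] (Suc k + k)"
        by (rule nat_pow_mult) simp
      finally show ?thesis by (simp add: mult_2 del: nat_pow_Suc)
    qed
    finally show ?thesis .
  qed
  ultimately show ?case
    unfolding snoc using Suc.IH words [of k]
    by (simp add: odd_refl_append prod c_def [symmetric] g_def [symmetric])
qed simp

text \<open>In the relator \<open>(st)^m\<close> the values \<open>(st)^j s\<close> repeat after
  \<open>m\<close> exponents, so every reflection is counted an even number of times. The append
  case also needs that congruent words have equal products.\<close>

lemma odd_refl_cong:
  "coxeter_cong W S u v \<Longrightarrow> t \<in> carrier W \<Longrightarrow> odd_refl u t = odd_refl v t"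
proof (induction arbitrary: t rule: coxeter_cong.induct)
  case (relation s t r)
  define m where "m = group.ord W (s \<otimes> t)"
  \<comment> \<open>For \<open>st\<close> of infinite order \<open>m\<close> is 0, the relator is
    the empty word, and the periodicity is trivial.\<close>
  have pow: "(s \<otimes> t) [^] (j + m) = (s \<otimes> t) [^] j" for j
    using relation by (simp add: nat_pow_mult [symmetric] m_def pow_ord_eq_1)
  define f :: "nat \<Rightarrow> nat" where "f j = (if r = (s \<otimes> t) [^] j \<otimes> s then 1 else 0)" for j
  have "(\<Sum>j<m + n. f j) = (\<Sum>j<m. f j) + (\<Sum>j<n. f (j + m))" for n
    by (induction n) (simp_all add: ac_simps)
  from this [of m] have "(\<Sum>j<2 * m. f j) = (\<Sum>j<m. f j) + (\<Sum>j<m. f (j + m))"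
    by (simp add: mult_2)
  also have "\<dots> = 2 * (\<Sum>j<m. f j)"
    by (simp add: f_def pow)
  finally have "even (\<Sum>j<2 * m. f j)" by simp
  then show ?case
    using relation odd_refl_power [of s t r m] by (simp add: f_def m_def)
next
  case (cong_append u v a b)
  then have "u \<in> lists S" "v \<in> lists S"
    using coxeter_cong_lists by auto
  moreover from this have "word_prod W u = word_prod W v"
    using cong_append.hyps(1) presentation by simp
  ultimately show ?case using cong_append
    by (simp add: odd_refl_append)
qed auto

lemma word_prod_eq_odd_refl:
  assumes "u \<in> lists S" "v \<in> lists S" "word_prod W u = word_prod W v" "t \<in> carrier W"
  shows "odd_refl u t = odd_refl v t"
  using assms presentation odd_refl_cong by blast

text \<open>An odd count means that \<open>t\<close> is attached to some prefix; left multiplication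
  by \<open>t\<close> then deletes the last letter of that prefix.\<close>

lemma odd_refl_exchange:
  assumes "u \<in> lists S" "t \<in> carrier W" "odd_refl u t"
  shows "\<exists>i<length u. t \<otimes> word_prod W u = word_prod W (take i u @ drop (Suc i) u)"
  using assms
proof (induction u arbitrary: t)
  case (Cons s u)
  show ?case
  proof (cases "t = s")
    case True
    moreover have "s \<in> S" "word_prod W u \<in> carrier W"
      using Cons.hyps by (simp_all add: word_prod_closed)
    ultimately show ?thesis
      by (intro exI [of _ 0]) simp
  next
    case False
    then have "odd_refl u (s \<otimes> t \<otimes> s)" "s \<otimes> t \<otimes> s \<in> carrier W"
      using Cons.hyps Cons.prems by auto
    then obtain i where i: "i < length u"
      "s \<otimes> t \<otimes> s \<otimes> word_prod W u = word_prod W (take i u @ drop (Suc i) u)"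
      using Cons.IH [of "s \<otimes> t \<otimes> s"] by blast
    have "t \<otimes> word_prod W (s # u) = s \<otimes> (s \<otimes> t \<otimes> s \<otimes> word_prod W u)"
      using Cons.hyps Cons.prems by (simp add: m_assoc word_prod_closed)
    also have "\<dots> = word_prod W (take (Suc i) (s # u) @ drop (Suc (Suc i)) (s # u))"
      by (simp only: i) simp
    finally show ?thesis using i(1) by (intro exI [of _ "Suc i"]) auto
  qed
qed simp

section \<open>The strong exchange condition\<close>

lemma reflection_word:
  assumes "t \<in> reflections"
  obtains u where "u \<in> lists S" "word_prod W u = t" "odd_refl u t"
proof -
  obtain w s where ws [simp]: "w \<in> carrier W" "s \<in> S" and t: "t = w \<otimes> s \<otimes> inv w"
    using assms by (auto simp: reflections_def)
  obtain v where v [simp]: "v \<in> lists S" and w: "word_prod W v = w"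
    using ex_word [OF ws(1)] .
  have t_closed [simp]: "t \<in> carrier W" using assms by auto
  have [simp]: "rev v \<in> lists S" using v by (auto simp: in_lists_conv_set)
  have conj: "inv w \<otimes> t \<otimes> w = s"
    by (simp add: t m_assoc)
  \<comment> \<open>\<open>v @ rev v\<close> represents the identity, so the contributions of
    \<open>v\<close> and \<open>rev v\<close> cancel. Inserting the letter \<open>s\<close>, whose
    attached reflection is \<open>t\<close>, makes the total odd.\<close>
  have "odd_refl (v @ rev v) t = odd_refl [] t"
    by (rule word_prod_eq_odd_refl) (simp_all add: word_prod_rev w)
  then have "odd_refl v t = odd_refl (rev v) s"
    by (simp add: odd_refl_append w conj)
  then have "odd_refl (v @ s # rev v) t"
    by (subst odd_refl_append) (simp_all add: w conj)
  moreover have "word_prod W (v @ s # rev v) = t"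
    by (simp add: w word_prod_rev t m_assoc)
  ultimately show ?thesis
    using that [of "v @ s # rev v"] by simp
qed

lemma odd_refl_less:
  assumes "u \<in> lists S" "t \<in> carrier W" "odd_refl u t"
  shows "len (t \<otimes> word_prod W u) < length u"
proof -
  obtain i where i: "i < length u" "t \<otimes> word_prod W u = word_prod W (take i u @ drop (Suc i) u)"
    using odd_refl_exchange [OF assms] by blast
  have "take i u @ drop (Suc i) u \<in> lists S"
    using assms(1) by (auto simp: in_lists_conv_set dest: in_set_takeD in_set_dropD)
  then show ?thesis using len_le [of "take i u @ drop (Suc i) u"] i by simp
qed

text \<open>Put a word for \<open>t\<close> with odd parity at \<open>t\<close> in front of
  \<open>u\<close>: it flips the parity once, and conjugating \<open>t\<close> by itself leaves the
  count in \<open>u\<close> unchanged.\<close>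

lemma odd_refl_reflection:
  assumes t: "t \<in> reflections" and uv: "u \<in> lists S" "v \<in> lists S"
    and eq: "word_prod W v = t \<otimes> word_prod W u"
  shows "odd_refl v t \<longleftrightarrow> \<not> odd_refl u t"
proof -
  obtain a where a: "a \<in> lists S" "word_prod W a = t" "odd_refl a t"
    using reflection_word [OF t] .
  have "odd_refl v t = odd_refl (a @ u) t"
    using a uv eq t by (intro word_prod_eq_odd_refl) auto
  also have "\<dots> \<longleftrightarrow> \<not> odd_refl u t"
    using a uv t by (simp add: odd_refl_append reflection_square reflection_closed)
  finally show ?thesis .
qed

text \<open>If the parity of \<open>u\<close> were even, a reduced word for
  \<open>t \<otimes> word_prod W u\<close> would have odd parity, and multiplying by
  \<open>t\<close> would shorten it, against \<open>less\<close>.\<close>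

lemma strong_exchange:
  assumes t: "t \<in> reflections" and u: "u \<in> lists S"
    and less: "len (t \<otimes> word_prod W u) < len (word_prod W u)"
  shows "\<exists>i<length u. t \<otimes> word_prod W u = word_prod W (take i u @ drop (Suc i) u)"
proof -
  have [simp]: "t \<in> carrier W" "word_prod W u \<in> carrier W" using t u by auto
  obtain v where v: "v \<in> lists S" "word_prod W v = t \<otimes> word_prod W u"
      "length v = len (t \<otimes> word_prod W u)"
    using ex_reduced [of "t \<otimes> word_prod W u"] by auto
  have "t \<otimes> word_prod W v = word_prod W u"
    using t v by (simp add: m_assoc [symmetric] reflection_square)
  then have "\<not> odd_refl v t"
    using odd_refl_less [of v t] v less by auto
  then have "odd_refl u t"
    using odd_refl_reflection [OF t u v(1,2)] by simp
  then show ?thesis using odd_refl_exchange u by auto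
qed

text \<open>Of reduced words for \<open>w\<close> and \<open>t \<otimes> w\<close> exactly one has
  odd parity, and \<open>t\<close> shortens the element it represents.\<close>

lemma len_reflection_neq:
  assumes t: "t \<in> reflections" and w: "w \<in> carrier W"
  shows "len (t \<otimes> w) \<noteq> len w"
proof -
  have tc: "t \<in> carrier W" using t by auto
  obtain u where u: "u \<in> lists S" "word_prod W u = w" "length u = len w"
    using ex_reduced [OF w] by auto
  obtain v where v: "v \<in> lists S" "word_prod W v = t \<otimes> w" "length v = len (t \<otimes> w)"
    using ex_reduced [of "t \<otimes> w"] tc w by auto
  have tt: "t \<otimes> (t \<otimes> w) = w"
    using t tc w by (simp add: m_assoc [symmetric] reflection_square)
  consider "odd_refl u t" | "odd_refl v t"
    using odd_refl_reflection [OF t u(1) v(1)] u v by blast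
  then show ?thesis
  proof cases
    case 1
    then show ?thesis using odd_refl_less [OF u(1) tc] u by simp
  next
    case 2
    then show ?thesis using odd_refl_less [OF v(1) tc] v tt by simp
  qed
qed

section \<open>The Bruhat order and its lifting property\<close>

lemma bruhat_step_iff:
  "bruhat_step u v \<longleftrightarrow> u \<in> carrier W \<and> (\<exists>t \<in> reflections. v = t \<otimes> u) \<and> len u < len v"
proof -
  \<comment> \<open>Right multiplication by \<open>t\<close> is left multiplication by its conjugate
    under \<open>u\<close>; strong exchange is available for left multiplication.\<close>
  have "(\<exists>t \<in> reflections. v = u \<otimes> t) \<longleftrightarrow> (\<exists>t \<in> reflections. v = t \<otimes> u)" if u: "u \<in> carrier W"
  proof safe
    fix t assume t: "t \<in> reflections"
    have "u \<otimes> t = (u \<otimes> t \<otimes> inv u) \<otimes> u"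
      using t u by (simp add: m_assoc reflection_closed)
    then show "\<exists>ta\<in>reflections. u \<otimes> t = ta \<otimes> u"
      using reflection_conj [OF t u] by auto
    have "t \<otimes> u = u \<otimes> (inv u \<otimes> t \<otimes> inv (inv u))"
      using t u by (simp add: m_assoc [symmetric] reflection_closed)
    then show "\<exists>ta\<in>reflections. t \<otimes> u = u \<otimes> ta"
      using reflection_conj [OF t, of "inv u"] u by auto
  qed
  then show ?thesis unfolding bruhat_step_def by blast
qed

lemma bruhat_le_refl [simp]: "bruhat_le x x"
  by (simp add: bruhat_le_def)

lemma bruhat_le_trans: "bruhat_le x y \<Longrightarrow> bruhat_le y z \<Longrightarrow> bruhat_le x z"
  by (simp add: bruhat_le_def)

lemma bruhat_step_le: "bruhat_step x y \<Longrightarrow> bruhat_le x y"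
  by (auto simp: bruhat_le_def)

lemma bruhat_le_len: "bruhat_le x y \<Longrightarrow> x = y \<or> len x < len y"
  unfolding bruhat_le_def by (induction rule: rtranclp_induct) (auto simp: bruhat_step_def)

lemma bruhat_antisym: "bruhat_le x y \<Longrightarrow> bruhat_le y x \<Longrightarrow> x = y"
  using bruhat_le_len [of x y] bruhat_le_len [of y x] by auto

lemma bruhat_le_gen:
  "s \<in> S \<Longrightarrow> w \<in> carrier W \<Longrightarrow> len w < len (s \<otimes> w) \<Longrightarrow> bruhat_le w (s \<otimes> w)"
  by (rule bruhat_step_le) (auto simp: bruhat_step_iff gen_reflection)

text \<open>The elements \<open>s \<otimes> u\<close> and \<open>s \<otimes> v\<close> differ by the
  reflection \<open>sts\<close>. If it shortens \<open>s \<otimes> u\<close>, exchange deletes a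
  letter of \<open>s # a\<close>; deleting a letter other than the leading \<open>s\<close> would
  write \<open>v\<close> with fewer than \<open>len u\<close> letters.\<close>

lemma bruhat_step_lift:
  assumes step: "bruhat_step u v" and s: "s \<in> S"
  shows "s \<otimes> u = v \<or> bruhat_step (s \<otimes> u) (s \<otimes> v)"
proof -
  obtain t where u: "u \<in> carrier W" and t: "t \<in> reflections" and v: "v = t \<otimes> u"
    and less: "len u < len v"
    using step by (auto simp: bruhat_step_iff)
  have [simp]: "t \<in> carrier W" "s \<in> carrier W" "u \<in> carrier W" using t s u by auto
  define t' where "t' = s \<otimes> t \<otimes> s"
  have t': "t' \<in> reflections"
    using reflection_conj [OF t, of s] s by (simp add: t'_def)
  have sv: "s \<otimes> v = t' \<otimes> (s \<otimes> u)"
    using s by (simp add: t'_def v m_assoc)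
  show ?thesis
  proof (cases "len (s \<otimes> u) < len (s \<otimes> v)")
    case True
    then show ?thesis using sv t' by (auto simp: bruhat_step_iff)
  next
    case False
    moreover have "len (s \<otimes> v) \<noteq> len (s \<otimes> u)"
      using len_reflection_neq [OF t', of "s \<otimes> u"] sv by simp
    ultimately have down: "len (t' \<otimes> (s \<otimes> u)) < len (s \<otimes> u)"
      using sv by simp
    obtain a where a: "a \<in> lists S" "word_prod W a = u" "length a = len u"
      using ex_reduced [OF u] by auto
    obtain i where i: "i < length (s # a)"
      and del: "s \<otimes> v = word_prod W (take i (s # a) @ drop (Suc i) (s # a))"
      using strong_exchange [OF t', of "s # a"] a s down sv by auto
    show ?thesis
    proof (cases i)
      case 0
      then have "s \<otimes> v = u" using del a by simp
      then have "s \<otimes> u = s \<otimes> (s \<otimes> v)" by simp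
      also have "\<dots> = v" using s by (simp add: v)
      finally show ?thesis ..
    next
      case (Suc j)
      define b where "b = take j a @ drop (Suc j) a"
      have b: "b \<in> lists S"
        using a(1) by (auto simp: b_def in_lists_conv_set dest: in_set_takeD in_set_dropD)
      have "s \<otimes> v = s \<otimes> word_prod W b"
        using del by (simp add: Suc b_def)
      then have "v = word_prod W b"
        using gen_cancel [OF s, of v] gen_cancel [OF s, of "word_prod W b"] b v by auto
      then have "len v \<le> length b"
        using len_le [OF b] by simp
      then show ?thesis
        using i less a by (simp add: b_def Suc)
    qed
  qed
qed

text \<open>A chain from \<open>x\<close> to \<open>w\<close> stays a chain after multiplication by
  \<open>s\<close>, except where a step joins some \<open>z\<close> to \<open>s \<otimes> z\<close>;
  from there the original chain is followed up to \<open>w\<close> and then to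
  \<open>s \<otimes> w\<close>.\<close>

lemma bruhat_lift:
  assumes le: "bruhat_le x w" and s: "s \<in> S" and w: "w \<in> carrier W" and up: "len w < len (s \<otimes> w)"
  shows "bruhat_le (s \<otimes> x) (s \<otimes> w)"
  using le unfolding bruhat_le_def
proof (induction rule: converse_rtranclp_induct)
  case (step x x')
  from bruhat_step_lift [OF step.hyps(1) s] show ?case
  proof
    assume "s \<otimes> x = x'"
    then show ?thesis
      using step.hyps(2) bruhat_le_gen [OF s w up] by (auto simp: bruhat_le_def)
  next
    assume "bruhat_step (s \<otimes> x) (s \<otimes> x')"
    then show ?thesis
      using step.IH by (rule converse_rtranclp_into_rtranclp)
  qed
qed simp

text \<open>As \<open>S\<close> may be infinite, bounding the length is not enough. By strong
  exchange every element below \<open>y\<close> is spelled with the letters of one fixed word for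
  \<open>y\<close> and no more of them.\<close>

lemma finite_bruhat_interval: "y \<in> carrier W \<Longrightarrow> finite {x. bruhat_le x y}"
proof -
  assume y: "y \<in> carrier W"
  obtain u where u: "u \<in> lists S" "word_prod W u = y"
    using ex_word [OF y] .
  have "\<exists>v \<in> lists S. set v \<subseteq> set u \<and> length v \<le> length u \<and> word_prod W v = x"
    if "bruhat_le x y" for x
    using that unfolding bruhat_le_def
  proof (induction rule: converse_rtranclp_induct)
    case base
    show ?case using u by auto
  next
    case (step x x')
    then obtain v where v: "v \<in> lists S" "set v \<subseteq> set u" "length v \<le> length u" "word_prod W v = x'"
      by auto
    obtain t where x: "x \<in> carrier W" and t: "t \<in> reflections" and x': "x' = t \<otimes> x"
      and less: "len x < len x'"
      using step.hyps(1) by (auto simp: bruhat_step_iff)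
    have tx: "t \<otimes> x' = x"
      using t x by (simp add: x' m_assoc [symmetric] reflection_square reflection_closed)
    obtain i where "i < length v" "x = word_prod W (take i v @ drop (Suc i) v)"
      using strong_exchange [OF t v(1)] v(4) tx less by auto
    then show ?case
      using v by (intro bexI [of _ "take i v @ drop (Suc i) v"])
        (auto simp: in_lists_conv_set dest: in_set_takeD in_set_dropD)
  qed
  then have "{x. bruhat_le x y} \<subseteq> word_prod W ` {v. set v \<subseteq> set u \<and> length v \<le> length u}"
    by blast
  then show "finite {x. bruhat_le x y}"
    by (rule finite_subset) (intro finite_imageI finite_lists_length_le, simp)
qed

section \<open>Left descents and suffixes\<close>

lemma ex_descent:
  assumes "y \<in> carrier W" "y \<noteq> \<one>"
  obtains s where "s \<in> S" "len (s \<otimes> y) < len y"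
proof -
  obtain u where u: "u \<in> lists S" "word_prod W u = y" "length u = len y"
    using ex_reduced [OF assms(1)] by auto
  obtain s v where sv: "u = s # v" "s \<in> S" "v \<in> lists S"
    using u assms(2) by (cases u) auto
  have "s \<otimes> y = word_prod W v"
    using u(2) gen_cancel [OF sv(2) word_prod_closed [OF sv(3)]] sv(1) by auto
  then show ?thesis
    using that [of s] len_le [of v] sv u(3) by simp
qed

lemma len_gen:
  assumes "s \<in> S" 
  shows "len s = 1"
proof -
  obtain u where u: "u \<in> lists S" "word_prod W u = s" "length u = len s"
    using ex_reduced [of s] assms by auto
  have "len s \<le> 1" using len_le [of "[s]"] assms by simp
  moreover have "len s \<noteq> 0"
  proof
    assume "len s = 0"
    then have "s = \<one>" using u by auto
    then show False using gens_involution [OF assms] by simp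
  qed
  ultimately show ?thesis by simp
qed

text \<open>A left descent lowers the length by exactly one; this keeps \<open>s \<otimes> y\<close>
  inside an ideal that contains \<open>y\<close>.\<close>

lemma suffix_gen:
  assumes s: "s \<in> S" and y: "y \<in> carrier W" and less: "len (s \<otimes> y) < len y"
  shows "is_suffix (s \<otimes> y) y"
proof -
  obtain u where u: "u \<in> lists S" "word_prod W u = s \<otimes> y" "length u = len (s \<otimes> y)"
    using ex_reduced [of "s \<otimes> y"] s y by auto
  have "len y \<le> Suc (len (s \<otimes> y))"
    using len_le [of "s # u"] u s y by simp
  then show ?thesis
    using less s y by (auto simp: is_suffix_def len_gen intro!: bexI [of _ s])
qed

end

section \<open>The group generated by the weights\<close>

context weighted_coxeter_system
begin

lemma int_mult_0 [simp]: "int_mult 0 \<gamma> = 0"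
  by (simp add: int_mult_def)

lemma int_mult_1 [simp]: "int_mult 1 \<gamma> = \<gamma>"
  by (simp add: int_mult_def)

lemma int_mult_minus [simp]: "int_mult (- n) \<gamma> = - int_mult n \<gamma>"
  by (auto simp: int_mult_def)

lemma int_mult_Suc: "int_mult (n + 1) \<gamma> = int_mult n \<gamma> + \<gamma>"
proof (cases "0 \<le> n")
  case True
  then show ?thesis by (simp add: int_mult_def nat_add_distrib)
next
  case False
  then have "nat (- n) = Suc (nat (- (n + 1)))" by simp
  with False show ?thesis by (auto simp: int_mult_def)
qed

lemma int_mult_add: "int_mult (m + n) \<gamma> = int_mult m \<gamma> + int_mult n \<gamma>"
proof (induction n rule: int_induct [where k = 0])
  case (step1 i)
  then show ?case using int_mult_Suc [of "m + i" \<gamma>] int_mult_Suc [of i \<gamma>] by (simp add: ac_simps)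
next
  case (step2 i)
  then show ?case
    using int_mult_Suc [of "m + (i - 1)" \<gamma>] int_mult_Suc [of "i - 1" \<gamma>] by (simp add: algebra_simps)
qed simp

lemma weight_group_diff:
  assumes "\<zeta> \<in> weight_group" "\<xi> \<in> weight_group"
  shows "\<zeta> - \<xi> \<in> weight_group"
proof -
  obtain F m where F: "finite F" "F \<subseteq> S" and \<zeta>: "\<zeta> = (\<Sum>s\<in>F. int_mult (m s) (L s))"
    using assms(1) by (auto simp: weight_group_def)
  obtain G n where G: "finite G" "G \<subseteq> S" and \<xi>: "\<xi> = (\<Sum>s\<in>G. int_mult (n s) (L s))"
    using assms(2) by (auto simp: weight_group_def)
  define k where "k s = (if s \<in> F then m s else 0) + - (if s \<in> G then n s else 0)" for s
  have "(\<Sum>s\<in>F \<union> G. int_mult (k s) (L s)) =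
    (\<Sum>s\<in>F \<union> G. int_mult (if s \<in> F then m s else 0) (L s)) -
    (\<Sum>s\<in>F \<union> G. int_mult (if s \<in> G then n s else 0) (L s))"
    unfolding k_def int_mult_add int_mult_minus by (simp add: sum_subtractf)
  also have "(\<Sum>s\<in>F \<union> G. int_mult (if s \<in> F then m s else 0) (L s)) = \<zeta>"
    unfolding \<zeta> using F G by (intro sum.mono_neutral_cong_right) auto
  also have "(\<Sum>s\<in>F \<union> G. int_mult (if s \<in> G then n s else 0) (L s)) = \<xi>"
    unfolding \<xi> using F G by (intro sum.mono_neutral_cong_right) auto
  finally show ?thesis
    unfolding weight_group_def using F G by (auto intro!: exI [of _ "F \<union> G"] exI [of _ k])
qed

lemma weight_group_zero: "0 \<in> weight_group"
  unfolding weight_group_def by (auto intro!: exI [of _ "{}"])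

lemma weight_group_add: "\<zeta> \<in> weight_group \<Longrightarrow> \<xi> \<in> weight_group \<Longrightarrow> \<zeta> + \<xi> \<in> weight_group"
  using weight_group_diff [of \<zeta> "0 - \<xi>"] weight_group_diff [OF weight_group_zero, of \<xi>] by simp

lemma weight_group_gen: "s \<in> S \<Longrightarrow> L s \<in> weight_group"
  unfolding weight_group_def by (auto intro!: exI [of _ "{s}"] exI [of _ "\<lambda>_. 1"])

lemma weight_in_weight_group:
  assumes "w \<in> carrier W"
  shows "L w \<in> weight_group"
proof -
  obtain u where u: "u \<in> lists S" "word_prod W u = w" "reduced u"
    using ex_reduced [OF assms] by auto
  have "sum_list (map L u) \<in> weight_group"
    using u(1) by (induction u) (auto simp: weight_group_zero weight_group_add weight_group_gen)
  then show ?thesis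
    using weight_reduced [OF u(3)] u(2) by simp
qed

end

section \<open>Triangularity of the bar involution\<close>

lemma q_pow_mult: "q_pow \<gamma> * q_pow \<zeta> = q_pow (\<gamma> + \<zeta>)"
  by (simp add: q_pow_def mult_single)

lemma q_pow_0: "q_pow 0 = 1"
  by (simp add: q_pow_def single_one)

lemma lookup_mult_group:
  fixes f g :: "'g::ab_group_add \<Rightarrow>\<^sub>0 'r::semiring_0"
  shows "Poly_Mapping.lookup (f * g) k =
    Sum_any (\<lambda>l. Poly_Mapping.lookup f l * Poly_Mapping.lookup g (k - l))"
proof -
  have "k = l + q \<longleftrightarrow> q = k - l" for l q
    by (auto simp: algebra_simps)
  then show ?thesis
    by (simp add: lookup_mult)
qed

lemma lookup_q_pow_times: "Poly_Mapping.lookup (q_pow \<gamma> * f) \<zeta> = Poly_Mapping.lookup f (\<zeta> - \<gamma>)"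
proof -
  have "Poly_Mapping.lookup (q_pow \<gamma> * f) \<zeta> = Sum_any (\<lambda>l. Poly_Mapping.lookup f (\<zeta> - l) when l = \<gamma>)"
    unfolding lookup_mult_group
    by (rule arg_cong [of _ _ Sum_any]) (auto simp: q_pow_def lookup_single when_def)
  then show ?thesis by simp
qed

context w_graph_ideal
begin

text \<open>Triangularity of the bar involution becomes membership of \<open>barM (Gam y)\<close> in
  this submodule, with no coefficients to follow.\<close>

definition lower_span :: "'w \<Rightarrow> 'm set" where
  "lower_span y = M.span (Gam ` {x \<in> E. bruhat_le x y})"

lemma Gam_lower_span: "x \<in> E \<Longrightarrow> bruhat_le x y \<Longrightarrow> Gam x \<in> lower_span y"
  by (auto simp: lower_span_def intro: M.span_base)

lemma lower_span_mono: "bruhat_le x y \<Longrightarrow> lower_span x \<subseteq> lower_span y"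
  unfolding lower_span_def by (rule M.span_mono) (auto intro: bruhat_le_trans)

text \<open>Each case of the action involves only \<open>Gam x\<close>,
  \<open>Gam (s \<otimes> x)\<close> and basis elements below \<open>s \<otimes> x\<close>. The
  first is below \<open>s \<otimes> w\<close> because \<open>w\<close> is, the others by the lifting
  property.\<close>

lemma act_Gam_lower_span:
  assumes s: "s \<in> S" and w: "w \<in> carrier W" and up: "len w < len (s \<otimes> w)"
    and x: "x \<in> E" and le: "bruhat_le x w"
  shows "act (T s) (Gam x) \<in> lower_span (s \<otimes> w)"
proof -
  have xc: "x \<in> carrier W" using x E_closed by auto
  have le': "bruhat_le x (s \<otimes> w)"
    using le bruhat_le_gen [OF s w up] by (rule bruhat_le_trans)
  have lift: "bruhat_le (s \<otimes> x) (s \<otimes> w)"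
    by (rule bruhat_lift [OF le s w up])
  have closed: "M.subspace (lower_span (s \<otimes> w))"
    by (simp add: lower_span_def)
  note closure = M.subspace_add [OF closed] M.subspace_diff [OF closed] M.subspace_neg [OF closed]
    M.subspace_scale [OF closed] M.subspace_sum [OF closed]
  have Gx: "Gam x \<in> lower_span (s \<otimes> w)"
    using x le' by (rule Gam_lower_span)
  \<comment> \<open>Multiplication by \<open>s\<close> always changes the length, so outside
    \<open>SD\<close> it goes up; the other three sets then sort by where
    \<open>s \<otimes> x\<close> lies.\<close>
  consider "s \<in> SD x" | "s \<in> SA E x" | "s \<in> WD J x" | "s \<in> WA E J x"
    using len_reflection_neq [OF gen_reflection [OF s] xc] s
    unfolding SD_def SA_def WD_def WA_def by fastforce
  then show ?thesis
  proof cases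
    case 1
    then have "is_suffix (s \<otimes> x) x"
      using suffix_gen [OF s xc] by (simp add: SD_def)
    then show ?thesis
      using x act_SD [OF x 1] E_ideal lift Gx
      by (auto intro!: closure Gam_lower_span)
  next
    case 2
    then show ?thesis
      using act_SA [OF x 2] lift by (auto simp: SA_def intro!: Gam_lower_span)
  next
    case 3
    then show ?thesis
      using act_WD [OF x 3] Gx by (auto intro!: closure)
  next
    case 4
    then show ?thesis
      using act_WA [OF x 4] Gx lift
      by (auto simp: bruhat_less_def intro!: closure Gam_lower_span intro: bruhat_le_trans)
  qed
qed

lemma act_lower_span:
  assumes s: "s \<in> S" and w: "w \<in> carrier W" and up: "len w < len (s \<otimes> w)"
    and m: "m \<in> lower_span w"
  shows "act (T s) m \<in> lower_span (s \<otimes> w)"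
proof -
  have closed: "M.subspace (lower_span (s \<otimes> w))"
    by (simp add: lower_span_def)
  have act0: "act h 0 = 0" for h
    using act_add_right [of h 0 0] by simp
  from m show ?thesis
    unfolding lower_span_def [of w]
  proof (induction rule: M.span_induct_alt)
    case base
    show ?case using M.subspace_0 [OF closed] by (simp add: act0)
  next
    case (step c g m)
    then obtain x where "g = Gam x" "x \<in> E" "bruhat_le x w" by auto
    then have "act (T s) g \<in> lower_span (s \<otimes> w)"
      using act_Gam_lower_span [OF s w up] by simp
    then show ?case
      using step M.subspace_add [OF closed] M.subspace_scale [OF closed]
      by (simp add: act_add_right act_scale_right)
  qed
qed

text \<open>A left descent \<open>s\<close> of \<open>y\<close> gives \<open>Gam y\<close> as
  \<open>T s\<close> applied to \<open>Gam w\<close> for the shorter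
  \<open>w = s \<otimes> y\<close> in \<open>E\<close>. The bar of \<open>T s\<close> is a
  combination of \<open>T s\<close> and 1, and both map the span below \<open>w\<close> into the
  span below \<open>y\<close>.\<close>

lemma barM_Gam_lower_span: "y \<in> E \<Longrightarrow> barM (Gam y) \<in> lower_span y"
proof (induction "len y" arbitrary: y rule: less_induct)
  case less
  have y: "y \<in> carrier W" using less.prems E_closed by auto
  show ?case
  proof (cases "y = \<one>")
    case True
    then show ?thesis
      using less.prems by (simp add: barM_Gam_one Gam_lower_span)
  next
    case False
    obtain s where s: "s \<in> S" and down: "len (s \<otimes> y) < len y"
      using ex_descent [OF y False] .
    define w where "w = s \<otimes> y"
    have w: "w \<in> carrier W" "s \<otimes> w = y" using s y by (auto simp: w_def)
    have wE: "w \<in> E"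
      using E_ideal [OF less.prems suffix_gen [OF s y down]] by (simp add: w_def)
    have up: "len w < len (s \<otimes> w)" using down w by (simp add: w_def)
    have IH: "barM (Gam w) \<in> lower_span w"
      using less.hyps [of w] down wE by (simp add: w_def)
    have closed: "M.subspace (lower_span y)"
      by (simp add: lower_span_def)
    have "act (T s) (Gam w) = Gam y"
      using act_SA [OF wE, of s] s up w less.prems by (simp add: SA_def)
    then have "barM (Gam y) = act (barH (T s)) (barM (Gam w))"
      using barM_act [of s w] s wE by simp
    also have "\<dots> = scaleM (q_pow (- L s)) (act (T s) (barM (Gam w))) +
        scaleM (q_pow (- L s) - 1) (barM (Gam w))"
      by (simp add: barH_T [OF s] act_add_left act_scale_left act_one)
    also have "\<dots> \<in> lower_span y"
    proof (intro M.subspace_add [OF closed] M.subspace_scale [OF closed])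
      show "act (T s) (barM (Gam w)) \<in> lower_span y"
        using act_lower_span [OF s w(1) up IH] w(2) by simp
      show "barM (Gam w) \<in> lower_span y"
        using IH lower_span_mono [OF bruhat_le_gen [OF s w(1) up]] w(2) by auto
    qed
    finally show ?thesis .
  qed
qed

text \<open>Up to a unit, \<open>R x y\<close> is the coordinate of \<open>barM (Gam y)\<close> at
  \<open>Gam x\<close>, and triangularity confines the nonzero coordinates to elements below
  \<open>y\<close>.\<close>

lemma R_family_eq_0:
  assumes R: "is_R_family R" and "x \<in> E" "y \<in> E" and nle: "\<not> bruhat_le x y"
  shows "R x y = 0"
proof (rule ccontr)
  assume "R x y \<noteq> 0"
  define F where "F = {x \<in> E. R x y \<noteq> 0}"
  define c where "c z = sgn_len z * sgn_len y * q_pow (- L y) * R z y" for z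
  have F: "finite F" "F \<subseteq> E" and bar: "barM (Gam y) = (\<Sum>z\<in>F. scaleM (c z) (Gam z))"
    using R \<open>y \<in> E\<close> by (auto simp: is_R_family_def F_def c_def)
  have "M.representation (Gam ` E) (barM (Gam y)) (Gam x) =
      (\<Sum>z\<in>F. c z * (if Gam x = Gam z then 1 else 0))"
    unfolding bar
  proof (subst M.representation_sum [OF Gam_independent])
    fix z assume "z \<in> F"
    then show "scaleM (c z) (Gam z) \<in> M.span (Gam ` E)"
      using F by (intro M.span_scale M.span_base) auto
  next
    have "M.representation (Gam ` E) (scaleM (c z) (Gam z)) (Gam x) =
        c z * (if Gam x = Gam z then 1 else 0)" if "z \<in> F" for z
    proof -
      have z: "Gam z \<in> Gam ` E" using that F by auto
      then show ?thesis
        by (simp only: M.representation_scale [OF Gam_independent M.span_base [OF z]]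
            M.representation_basis [OF Gam_independent z])
    qed
    then show "(\<Sum>z\<in>F. M.representation (Gam ` E) (scaleM (c z) (Gam z)) (Gam x)) =
        (\<Sum>z\<in>F. c z * (if Gam x = Gam z then 1 else 0))"
      by (rule sum.cong [OF refl])
  qed
  also have "\<dots> = (\<Sum>z\<in>F. if z = x then c x else 0)"
    using F \<open>x \<in> E\<close> Gam_inj by (intro sum.cong) (auto simp: inj_on_def)
  also have "\<dots> = c x"
    using F \<open>R x y \<noteq> 0\<close> \<open>x \<in> E\<close> by (simp add: F_def)
  finally have rep: "M.representation (Gam ` E) (barM (Gam y)) (Gam x) = c x" .
  \<comment> \<open>Coordinates do not change when the basis is cut down to a subset whose span
    contains the vector; off this subset they vanish.\<close>
  have "M.representation (Gam ` E) (barM (Gam y)) =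
      M.representation (Gam ` {z \<in> E. bruhat_le z y}) (barM (Gam y))"
    using barM_Gam_lower_span [OF \<open>y \<in> E\<close>] Gam_independent
    by (intro M.representation_extend) (auto simp: lower_span_def)
  moreover have "Gam x \<notin> Gam ` {z \<in> E. bruhat_le z y}"
    using nle \<open>x \<in> E\<close> Gam_inj by (auto simp: inj_on_def)
  ultimately have "c x = 0"
    using rep M.representation_ne_zero [of "Gam ` {z \<in> E. bruhat_le z y}" "barM (Gam y)" "Gam x"]
    by auto
  moreover have "sgn_len x * sgn_len y * q_pow (L y) * c x = R x y"
  proof -
    have "sgn_len z * sgn_len z = (1 :: 'g group_ring)" for z
      by (simp add: sgn_len_def flip: power_mult_distrib)
    moreover have "q_pow (L y) * q_pow (- L y) = 1"
      by (simp add: q_pow_mult q_pow_0)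
    moreover have "sgn_len x * sgn_len y * q_pow (L y) * c x =
        (sgn_len x * sgn_len x) * (sgn_len y * sgn_len y) * (q_pow (L y) * q_pow (- L y)) * R x y"
      by (simp add: c_def ac_simps)
    ultimately show ?thesis by simp
  qed
  ultimately show False
    using \<open>R x y \<noteq> 0\<close> by simp
qed

end

section \<open>Sums over multichains and index sets\<close>

lemma Sum_any_inj_image:
  assumes "inj h" "\<And>a. g a \<noteq> 0 \<Longrightarrow> a \<in> range h"
  shows "Sum_any g = Sum_any (\<lambda>b. g (h b))"
proof -
  have "{a. g a \<noteq> 0} = h ` {b. g (h b) \<noteq> 0}"
    using assms(2) by auto
  then show ?thesis
    unfolding Sum_any.expand_set
    by (simp add: sum.reindex inj_on_subset [OF assms(1)] o_def)
qed

lemma Sum_any_fibre: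
  assumes "finite {a. g a \<noteq> 0}"
  shows "Sum_any g = Sum_any (\<lambda>b. Sum_any (\<lambda>a. g a when h a = b))"
proof -
  define A where "A = {a. g a \<noteq> 0}"
  have fin: "finite A" using assms by (simp add: A_def)
  have inner: "Sum_any (\<lambda>a. g a when h a = b) = sum g {a \<in> A. h a = b}" for b
    using fin by (subst Sum_any.expand_superset [of A])
      (auto simp: A_def when_def sum.If_cases Int_def intro!: sum.cong)
  have "Sum_any g = sum g A"
    by (simp add: Sum_any.expand_set A_def)
  also have "\<dots> = (\<Sum>b\<in>h ` A. sum g {a \<in> A. h a = b})"
    by (rule sum.image_gen [OF fin])
  also have "\<dots> = Sum_any (\<lambda>b. sum g {a \<in> A. h a = b})"
    using fin by (intro Sum_any.expand_superset [symmetric]) (auto intro: sum.neutral)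
  finally show ?thesis by (simp add: inner)
qed

lemma finite_lookup_shift:
  fixes f :: "'g::ab_group_add \<Rightarrow>\<^sub>0 'r::zero"
  shows "finite {b. Poly_Mapping.lookup f (c + b) \<noteq> 0}"
proof -
  have "{b. Poly_Mapping.lookup f (c + b) \<noteq> 0} \<subseteq> (\<lambda>\<zeta>. \<zeta> - c) ` Poly_Mapping.keys f"
  proof
    fix b assume "b \<in> {b. Poly_Mapping.lookup f (c + b) \<noteq> 0}"
    then have "c + b \<in> Poly_Mapping.keys f" by (simp add: in_keys_iff)
    then show "b \<in> (\<lambda>\<zeta>. \<zeta> - c) ` Poly_Mapping.keys f" by (rule rev_image_eqI) simp
  qed
  then show ?thesis by (rule finite_subset) simp
qed

section \<open>Recursive decomposition of multichains\<close>

context coxeter_system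
begin

lemma multichains_0:
  assumes "u \<in> E" "y \<in> E" "bruhat_le u y"
  shows "multichains E 0 u y = {[u, y]}"
  using assms by (auto simp: multichains_def length_Suc_conv numeral_2_eq_2)

lemma multichains_Cons:
  "v # xs \<in> multichains E (Suc r) u y \<longleftrightarrow>
    v = u \<and> u \<in> E \<and> bruhat_le u (xs ! 0) \<and> xs \<in> multichains E r (xs ! 0) y"
proof -
  have split: "(\<forall>i\<le>Suc r. Q i) \<longleftrightarrow> Q 0 \<and> (\<forall>i\<le>r. Q (Suc i))" for Q
    using All_less_Suc2 [of "Suc r" Q] by (simp only: less_Suc_eq_le)
  show ?thesis
    unfolding multichains_def mem_Collect_eq split by auto
qed

lemma multichains_Suc:
  "multichains E (Suc r) u y =
    {u # xs | xs. u \<in> E \<and> bruhat_le u (xs ! 0) \<and> xs \<in> multichains E r (xs ! 0) y}"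
proof (intro Set.set_eqI)
  fix zs
  show "zs \<in> multichains E (Suc r) u y \<longleftrightarrow>
    zs \<in> {u # xs | xs. u \<in> E \<and> bruhat_le u (xs ! 0) \<and> xs \<in> multichains E r (xs ! 0) y}"
    by (cases zs) (auto simp: multichains_Cons, simp add: multichains_def)
qed

lemma multichains_le: "xs \<in> multichains E r u y \<Longrightarrow> bruhat_le u y"
proof (induction r arbitrary: u xs)
  case 0
  then show ?case by (auto simp: multichains_def)
next
  case (Suc r)
  then show ?case by (auto simp: multichains_Suc intro: bruhat_le_trans)
qed

text \<open>A multichain amounts to its second element \<open>t\<close> and its part from
  \<open>t\<close> on; the \<open>SIGMA\<close> form lets sums be reindexed as double sums.\<close>

lemma multichains_Suc_image:
  assumes "u \<in> E"
  shows "multichains E (Suc r) u y =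
    (\<lambda>(t, xs). u # xs) ` (SIGMA t:{t \<in> E. bruhat_le u t \<and> bruhat_le t y}. multichains E r t y)"
proof -
  let ?A = "SIGMA t:{t \<in> E. bruhat_le u t \<and> bruhat_le t y}. multichains E r t y"
  have head: "xs ! 0 = t \<and> t \<in> E" if "xs \<in> multichains E r t y" for xs t
    using that by (auto simp: multichains_def dest!: nth_mem [of 0])
  show ?thesis
  proof (intro equalityI subsetI)
    fix zs assume "zs \<in> multichains E (Suc r) u y"
    then obtain xs where xs: "zs = u # xs" "bruhat_le u (xs ! 0)" "xs \<in> multichains E r (xs ! 0) y"
      by (auto simp: multichains_Suc)
    then have "(xs ! 0, xs) \<in> ?A"
      using head multichains_le by blast
    then show "zs \<in> (\<lambda>(t, xs). u # xs) ` ?A"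
      by (rule rev_image_eqI) (simp add: xs)
  next
    fix zs assume "zs \<in> (\<lambda>(t, xs). u # xs) ` ?A"
    then obtain t xs where "zs = u # xs" "bruhat_le u t" "xs \<in> multichains E r t y"
      by auto
    then show "zs \<in> multichains E (Suc r) u y"
      using assms head [of xs t] by (simp add: multichains_Cons)
  qed
qed

lemma finite_multichains:
  assumes "E \<subseteq> carrier W" "y \<in> E"
  shows "finite (multichains E r u y)"
proof (induction r arbitrary: u)
  case 0
  have "multichains E 0 u y \<subseteq> {[u, y]}"
    by (auto simp: multichains_def length_Suc_conv numeral_2_eq_2)
  then show ?case by (rule finite_subset) simp
next
  case (Suc r)
  have "finite {t \<in> E. bruhat_le u t \<and> bruhat_le t y}"
    using assms by (intro finite_subset [OF _ finite_bruhat_interval [of y]]) auto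
  then show ?case
    using Suc.IH by (cases "u \<in> E") (auto simp: multichains_Suc_image, simp add: multichains_Suc)
qed

end

section \<open>Contribution of the multichains of a fixed length\<close>

context weighted_coxeter_system
begin

text \<open>The end point \<open>y\<close> is a separate argument, so it is unaffected when the
  first element of \<open>xs\<close> is split off.\<close>

definition chain_term :: "('w \<Rightarrow> 'w \<Rightarrow> 'g group_ring) \<Rightarrow> 'w \<Rightarrow> nat \<Rightarrow> 'w list \<Rightarrow> 'g list \<Rightarrow> int" where
  "chain_term R y r xs a = (\<Prod>i \<le> r. Poly_Mapping.lookup (R (xs ! i) (xs ! (i + 1)))
     (L (xs ! (i + 1)) - L y + a ! i + a ! (i + 1)))"

definition chain_sum :: "'w set \<Rightarrow> ('w \<Rightarrow> 'w \<Rightarrow> 'g group_ring) \<Rightarrow> 'w \<Rightarrow> nat \<Rightarrow> 'w \<Rightarrow> 'g \<Rightarrow> int" where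
  "chain_sum E R y r u \<gamma> =
    (\<Sum>xs \<in> multichains E r u y. Sum_any (\<lambda>a. chain_term R y r xs a when a \<in> index_set \<gamma> r xs))"

lemma chain_term_Cons:
  "chain_term R y (Suc r) (u # xs) (a # as) =
    Poly_Mapping.lookup (R u (xs ! 0)) (L (xs ! 0) - L y + a + as ! 0) * chain_term R y r xs as"
  unfolding chain_term_def by (subst prod.atMost_Suc_shift) simp

lemma index_set_nth_0: "a \<in> index_set \<gamma> r xs \<Longrightarrow> a ! 0 = L (xs ! (r + 1)) - L (xs ! 0) - \<gamma>"
  by (simp add: index_set_def)

text \<open>With \<open>t = xs ! 0\<close> and \<open>b = as ! 0\<close>, the tail is an index tuple
  for the parameter \<open>L y - L t - b\<close>: the first entry prescribed there is
  \<open>b\<close> itself, and the bound on its second entry is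
  \<open>L y - L t - b \<ge> as ! 1\<close>. The inequality \<open>b > as ! 1\<close> follows by
  transitivity.\<close>

lemma index_set_Cons:
  assumes xs: "length xs = r + 2" "xs ! (r + 1) = y"
    and wg: "L y - L u - \<gamma> \<in> weight_group"
  shows "a # as \<in> index_set \<gamma> (Suc r) (u # xs) \<longleftrightarrow>
    a = L y - L u - \<gamma> \<and> as ! 0 \<le> \<gamma> \<and> L y - L (xs ! 0) - as ! 0 < as ! 0 \<and>
    as \<in> index_set (L y - L (xs ! 0) - as ! 0) r xs" (is "?l \<longleftrightarrow> ?r")
proof -
  have split: "(\<forall>i \<in> {1..Suc r}. Q i) \<longleftrightarrow> Q 1 \<and> (\<forall>i \<in> {1..r}. Q (Suc i))" for Q
  proof -
    have "{1..Suc r} = insert 1 (Suc ` {1..r})"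
      by (auto simp: image_Suc_atLeastAtMost)
    then show ?thesis by (simp only: ball_simps)
  qed
  show ?thesis
    unfolding index_set_def mem_Collect_eq split using xs wg
    by (auto simp: nth_Cons')
qed

text \<open>The only multichain is \<open>[u, y]\<close>, and the only candidate tuple is
  \<open>[L y - L u - \<gamma>, 0]\<close>. It is admissible when \<open>0 \<le> \<gamma>\<close>;
  for negative \<open>\<gamma>\<close> both sides vanish, the right one by the exponent
  bound.\<close>

lemma chain_sum_0:
  assumes E: "E \<subseteq> carrier W" "u \<in> E" "y \<in> E" and le: "bruhat_le u y"
    and \<gamma>: "\<gamma> \<in> weight_group"
    and exponents: "\<And>\<zeta>. Poly_Mapping.lookup (R u y) \<zeta> \<noteq> 0 \<Longrightarrow> \<zeta> \<le> L y - L u"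
  shows "chain_sum E R y 0 u \<gamma> = Poly_Mapping.lookup (R u y) (L y - L u - \<gamma>)"
proof (cases "0 \<le> \<gamma>")
  case True
  have "L y - L u - \<gamma> \<in> weight_group"
    using E \<gamma> by (auto intro!: weight_group_diff weight_in_weight_group)
  then have "a \<in> index_set \<gamma> 0 [u, y] \<longleftrightarrow> a = [L y - L u - \<gamma>, 0]" for a
    using True by (auto simp: index_set_def length_Suc_conv numeral_2_eq_2 weight_group_zero)
  then have "chain_sum E R y 0 u \<gamma> = chain_term R y 0 [u, y] [L y - L u - \<gamma>, 0]"
    using E le by (simp add: chain_sum_def multichains_0)
  also have "\<dots> = Poly_Mapping.lookup (R u y) (L y - L u - \<gamma>)"
    by (simp add: chain_term_def)
  finally show ?thesis .
next
  case False
  then have "index_set \<gamma> 0 [u, y] = {}"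
    by (auto simp: index_set_def)
  moreover have "Poly_Mapping.lookup (R u y) (L y - L u - \<gamma>) = 0"
    using exponents [of "L y - L u - \<gamma>"] False by (auto simp: algebra_simps)
  ultimately show ?thesis
    using E le by (simp add: chain_sum_def multichains_0)
qed

text \<open>The first entry of a tuple is forced by \<open>\<gamma>\<close>, so the sum runs over
  tails; grouping them by their head \<open>b\<close> pulls out the first factor.\<close>

lemma Sum_any_index_set_Cons:
  assumes xs: "length xs = r + 2" "xs ! (r + 1) = y" "xs ! 0 = t"
    and wg: "L y - L u - \<gamma> \<in> weight_group"
  shows "Sum_any (\<lambda>a. chain_term R y (Suc r) (u # xs) a when a \<in> index_set \<gamma> (Suc r) (u # xs)) =
    Sum_any (\<lambda>b. Poly_Mapping.lookup (R u t) (L t - L u - \<gamma> + b) *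
        Sum_any (\<lambda>a. chain_term R y r xs a when a \<in> index_set (L y - L t - b) r xs)
      when b \<le> \<gamma> \<and> L y - L t - b < b)"
    (is "Sum_any ?g = Sum_any (\<lambda>b. ?\<rho> b * Sum_any (?k b) when ?c b)")
proof -
  define a0 where "a0 = L y - L u - \<gamma>"
  have finite_g: "finite {a. ?g a \<noteq> 0}"
    using finite_index_support [of \<gamma> "Suc r" "u # xs" R y] unfolding chain_term_def
    by (rule rev_finite_subset) auto
  have finite_k: "finite {a. ?k b a \<noteq> 0}" for b
    using finite_index_support [of "L y - L t - b" r xs R y] unfolding chain_term_def
    by (rule rev_finite_subset) auto
  have g_Cons: "?g (a # as) =
      ((?\<rho> (as ! 0) * ?k (as ! 0) as when ?c (as ! 0)) when a = a0)" for a as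
  proof (cases "a = a0")
    case True
    have exponent: "L t - L y + a0 + as ! 0 = L t - L u - \<gamma> + as ! 0"
      by (simp add: a0_def)
    show ?thesis
      unfolding True index_set_Cons [OF xs(1,2) wg] chain_term_Cons xs(3) exponent
      by (simp add: when_def a0_def)
  next
    case False
    then show ?thesis
      by (simp add: index_set_Cons [OF xs(1,2) wg] a0_def)
  qed
  have g_range: "a \<in> range ((#) a0)" if "?g a \<noteq> 0" for a
  proof -
    have "length a = Suc r + 2"
      using that by (auto simp: index_set_def when_def split: if_splits)
    then obtain b as where "a = b # as" by (cases a) auto
    then show ?thesis using that g_Cons [of b as] by (auto simp: when_def split: if_splits)
  qed
  have finite_g': "finite {as. ?g (a0 # as) \<noteq> 0}"
    using finite_vimageI [OF finite_g, of "(#) a0"] by (simp add: vimage_def)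
  have "Sum_any ?g = Sum_any (\<lambda>as. ?g (a0 # as))"
    using g_range by (intro Sum_any_inj_image) (auto simp: inj_def)
  also have "\<dots> = Sum_any (\<lambda>b. Sum_any (\<lambda>as. ?g (a0 # as) when as ! 0 = b))"
    by (rule Sum_any_fibre [OF finite_g'])
  also have "\<dots> = Sum_any (\<lambda>b. ?\<rho> b * Sum_any (?k b) when ?c b)"
  proof (rule arg_cong [of _ _ Sum_any], rule ext)
    fix b
    have eq: "(?g (a0 # as) when (as ! 0 = b)) = (?\<rho> b * ?k b as when ?c b)" for as
    proof (cases "as ! 0 = b")
      case True
      then show ?thesis unfolding g_Cons by (auto simp: when_def)
    next
      case False
      \<comment> \<open>Tuples of this index set start with
        \<open>L y - L t - (L y - L t - b) = b\<close>, so the inner sum carries no separate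
        condition on the head.\<close>
      then have "as \<notin> index_set (L y - L t - b) r xs"
        using index_set_nth_0 [of as "L y - L t - b" r xs] xs by auto
      with False show ?thesis by simp
    qed
    show "Sum_any (\<lambda>as. ?g (a0 # as) when as ! 0 = b) = (?\<rho> b * Sum_any (?k b) when ?c b)"
      unfolding eq by (cases "?c b") (simp_all add: Sum_any_right_distrib [OF finite_k])
  qed
  finally show ?thesis .
qed

text \<open>The form is chosen to match \<open>KL_recursion\<close>: same factor from
  \<open>R\<close>, same conditions on \<open>b\<close>, with \<open>chain_sum\<close> in place of
  the coefficients of \<open>P\<close>.\<close>

lemma chain_sum_Suc:
  assumes E: "E \<subseteq> carrier W" "u \<in> E" "y \<in> E" and \<gamma>: "\<gamma> \<in> weight_group"
  shows "chain_sum E R y (Suc r) u \<gamma> =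
    (\<Sum>t \<in> {t \<in> E. bruhat_le u t \<and> bruhat_le t y}.
      Sum_any (\<lambda>b. Poly_Mapping.lookup (R u t) (L t - L u - \<gamma> + b) * chain_sum E R y r t (L y - L t - b)
        when b \<le> \<gamma> \<and> L y - L t - b < b))"
proof -
  let ?I = "{t \<in> E. bruhat_le u t \<and> bruhat_le t y}"
  let ?k = "\<lambda>t b xs. Sum_any (\<lambda>a. chain_term R y r xs a when a \<in> index_set (L y - L t - b) r xs)"
  let ?\<rho> = "\<lambda>t b. Poly_Mapping.lookup (R u t) (L t - L u - \<gamma> + b)"
  let ?c = "\<lambda>t b. b \<le> \<gamma> \<and> L y - L t - b < b"
  have wg: "L y - L u - \<gamma> \<in> weight_group"
    using E \<gamma> by (auto intro!: weight_group_diff weight_in_weight_group)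
  have fin: "finite ?I"
    using E by (intro finite_subset [OF _ finite_bruhat_interval [of y]]) auto
  have nth_0: "xs ! 0 = t" if "xs \<in> multichains E r t y" for xs t
    using that by (simp add: multichains_def)
  have inj: "inj_on (\<lambda>(t, xs). u # xs) (SIGMA t:?I. multichains E r t y)"
  proof (rule inj_onI, clarify)
    fix t t' xs
    assume "xs \<in> multichains E r t y" "xs \<in> multichains E r t' y"
    then show "t = t' \<and> xs = xs" using nth_0 by blast
  qed
  have "chain_sum E R y (Suc r) u \<gamma> = (\<Sum>t\<in>?I. \<Sum>xs\<in>multichains E r t y.
      Sum_any (\<lambda>a. chain_term R y (Suc r) (u # xs) a when a \<in> index_set \<gamma> (Suc r) (u # xs)))"
    unfolding chain_sum_def multichains_Suc_image [OF E(2)]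
    using E
    by (subst sum.reindex [OF inj]) (simp add: sum.Sigma fin finite_multichains split_beta)
  also have "\<dots> = (\<Sum>t\<in>?I. \<Sum>xs\<in>multichains E r t y. Sum_any (\<lambda>b. ?\<rho> t b * ?k t b xs when ?c t b))"
    by (intro sum.cong refl Sum_any_index_set_Cons [OF _ _ _ wg]) (simp_all add: multichains_def)
  also have "\<dots> = (\<Sum>t\<in>?I. Sum_any (\<lambda>b. ?\<rho> t b * chain_sum E R y r t (L y - L t - b) when ?c t b))"
  proof (rule sum.cong [OF refl])
    fix t
    \<comment> \<open>Outside this finite set the first factor vanishes whatever the chain, so one
      set serves all chains and the sums can be swapped.\<close>
    let ?B = "{b. ?\<rho> t b \<noteq> 0}"
    have B: "finite ?B" by (rule finite_lookup_shift)
    have "(\<Sum>xs\<in>multichains E r t y. Sum_any (\<lambda>b. ?\<rho> t b * ?k t b xs when ?c t b)) =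
        (\<Sum>xs\<in>multichains E r t y. \<Sum>b\<in>?B. ?\<rho> t b * ?k t b xs when ?c t b)"
      by (intro sum.cong refl Sum_any.expand_superset [OF B]) (auto simp: when_def)
    also have "\<dots> = (\<Sum>b\<in>?B. \<Sum>xs\<in>multichains E r t y. ?\<rho> t b * ?k t b xs when ?c t b)"
      by (rule sum.swap)
    also have "\<dots> = (\<Sum>b\<in>?B. ?\<rho> t b * chain_sum E R y r t (L y - L t - b) when ?c t b)"
    proof (rule sum.cong [OF refl])
      fix b
      show "(\<Sum>xs\<in>multichains E r t y. ?\<rho> t b * ?k t b xs when ?c t b) =
          (?\<rho> t b * chain_sum E R y r t (L y - L t - b) when ?c t b)"
        by (cases "?c t b") (simp_all add: chain_sum_def sum_distrib_left)
    qed
    also have "\<dots> = Sum_any (\<lambda>b. ?\<rho> t b * chain_sum E R y r t (L y - L t - b) when ?c t b)"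
      by (intro Sum_any.expand_superset [OF B, symmetric]) (auto simp: when_def)
    finally show "(\<Sum>xs\<in>multichains E r t y. Sum_any (\<lambda>b. ?\<rho> t b * ?k t b xs when ?c t b)) =
        Sum_any (\<lambda>b. ?\<rho> t b * chain_sum E R y r t (L y - L t - b) when ?c t b)" .
  qed
  finally show ?thesis .
qed

end

section \<open>Coefficients of Kazhdan--Lusztig polynomials\<close>

context w_graph_ideal
begin

text \<open>The summand \<open>t = y\<close> yields the isolated coefficient of
  \<open>R u y\<close>, since \<open>P y y = 1\<close>. For the other \<open>t\<close> the
  conditions on \<open>b\<close> may be imposed because they hold wherever the summand is
  nonzero.\<close>

lemma KL_recursion:
  assumes KL: "is_KL_family R P" and u: "u \<in> E" and y: "y \<in> E" and le: "bruhat_le u y"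
    and exponents: "\<And>t \<zeta>. t \<in> E \<Longrightarrow> bruhat_le u t \<Longrightarrow>
      Poly_Mapping.lookup (R u t) \<zeta> \<noteq> 0 \<Longrightarrow> \<zeta> \<le> L t - L u"
  shows "Poly_Mapping.lookup (P u y) \<gamma> = Poly_Mapping.lookup (R u y) (L y - L u - \<gamma>) +
    (\<Sum>t \<in> {t \<in> E. bruhat_le u t \<and> bruhat_le t y}.
      Sum_any (\<lambda>b. Poly_Mapping.lookup (R u t) (L t - L u - \<gamma> + b) *
          Poly_Mapping.lookup (P t y) (L y - L t - b)
        when b \<le> \<gamma> \<and> L y - L t - b < b))"
proof -
  let ?I = "{t \<in> E. bruhat_le u t \<and> bruhat_le t y}"
  let ?f = "\<lambda>t b. Poly_Mapping.lookup (R u t) (L t - L u - \<gamma> + b) *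
      Poly_Mapping.lookup (P t y) (L y - L t - b)"
  let ?c = "\<lambda>t b. b \<le> \<gamma> \<and> L y - L t - b < b"
  have fin: "finite ?I"
    using E_closed y by (intro finite_subset [OF _ finite_bruhat_interval [of y]]) auto
  have P_diag: "P y y = 1"
    using KL y by (auto simp: is_KL_family_def)
  have degree: "\<zeta> + \<zeta> < L y - L t"
    if "t \<in> E" "bruhat_less t y" "Poly_Mapping.lookup (P t y) \<zeta> \<noteq> 0" for t \<zeta>
  proof -
    have "P t y \<noteq> 0" using that by auto
    moreover have "deg (P t y) + deg (P t y) < Fin (L y - L t)"
      using KL that(1,2) y by (auto simp: is_KL_family_def)
    ultimately have "Max (Poly_Mapping.keys (P t y)) + Max (Poly_Mapping.keys (P t y)) < L y - L t"
      by (simp add: deg_def)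
    moreover have "\<zeta> \<le> Max (Poly_Mapping.keys (P t y))"
      using that by (intro Max_ge) (auto simp: in_keys_iff)
    ultimately show ?thesis
      using add_mono [of \<zeta> _ \<zeta>] by (meson le_less_trans)
  qed
  have coeff: "Poly_Mapping.lookup (R u t * P t y) (L y - L u - \<gamma>) = Sum_any (?f t)" for t
  proof -
    have "Poly_Mapping.lookup (R u t * P t y) (L y - L u - \<gamma>) =
        Sum_any (\<lambda>\<zeta>. Poly_Mapping.lookup (P t y) \<zeta> *
          Poly_Mapping.lookup (R u t) (L y - L u - \<gamma> - \<zeta>))"
      by (simp add: lookup_mult_group mult.commute [of "R u t"])
    also have "\<dots> = Sum_any (\<lambda>b. Poly_Mapping.lookup (P t y) (L y - L t - b) *
          Poly_Mapping.lookup (R u t) (L y - L u - \<gamma> - (L y - L t - b)))"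
    proof (rule Sum_any_inj_image)
      show "inj (\<lambda>b. L y - L t - b)" by (auto simp: inj_def)
      show "\<zeta> \<in> range (\<lambda>b. L y - L t - b)" for \<zeta>
        by (rule range_eqI [of _ _ "L y - L t - \<zeta>"]) simp
    qed
    also have "\<dots> = Sum_any (?f t)"
    proof -
      have "L y - L u - \<gamma> - (L y - L t - b) = L t - L u - \<gamma> + b" for b
        by (simp add: algebra_simps)
      then show ?thesis by (simp only: mult.commute)
    qed
    finally show ?thesis .
  qed
  have restrict: "Sum_any (?f t) = Sum_any (\<lambda>b. ?f t b when ?c t b)" if "t \<in> ?I - {y}" for t
  proof -
    have "?c t b" if "?f t b \<noteq> 0" for b
    proof
      show "b \<le> \<gamma>"
        using exponents [of t "L t - L u - \<gamma> + b"] \<open>t \<in> ?I - {y}\<close> that by (auto simp: algebra_simps)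
      show "L y - L t - b < b"
        using degree [of t "L y - L t - b"] \<open>t \<in> ?I - {y}\<close> that
        by (auto simp: bruhat_less_def algebra_simps)
    qed
    then have "?f t b = (?f t b when ?c t b)" for b
      by (auto simp only: when_def split: if_split)
    then show ?thesis by presburger
  qed
  have diag: "Sum_any (?f y) = Poly_Mapping.lookup (R u y) (L y - L u - \<gamma>)"
  proof -
    have "?f y b = (Poly_Mapping.lookup (R u y) (L y - L u - \<gamma>) when b = 0)" for b
      by (auto simp: P_diag lookup_one when_def)
    then show ?thesis by simp
  qed
  \<comment> \<open>At \<open>t = y\<close> only \<open>b = 0\<close> could contribute, and
    \<open>L y - L y - b < b\<close> excludes it; so \<open>y\<close> can be put back into the range
    of \<open>t\<close>.\<close>
  have diag_restrict: "(?f y b when ?c y b) = 0" for b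
    by (auto simp: P_diag lookup_one when_def)
  have "Poly_Mapping.lookup (P u y) \<gamma> =
      Poly_Mapping.lookup (q_pow (- L u) * q_pow (L y) * bar (P u y)) (L y - L u - \<gamma>)"
    by (simp add: q_pow_mult lookup_q_pow_times lookup_bar)
  also have "\<dots> = (\<Sum>t\<in>?I. Sum_any (?f t))"
    using KL u y by (simp add: is_KL_family_def lookup_sum coeff)
  also have "\<dots> = Sum_any (?f y) + (\<Sum>t\<in>?I - {y}. Sum_any (?f t))"
    using y le by (intro sum.remove [OF fin]) simp
  also have "(\<Sum>t\<in>?I - {y}. Sum_any (?f t)) = (\<Sum>t\<in>?I - {y}. Sum_any (\<lambda>b. ?f t b when ?c t b))"
    by (intro sum.cong refl restrict)
  also have "\<dots> = (\<Sum>t\<in>?I. Sum_any (\<lambda>b. ?f t b when ?c t b))"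
    using fin diag_restrict by (intro sum.mono_neutral_left) auto
  finally show ?thesis by (simp only: diag)
qed

text \<open>This is the identity defining \<open>P\<close> on a one-element interval.\<close>

lemma R_diag: "is_KL_family R P \<Longrightarrow> u \<in> E \<Longrightarrow> R u u = 1"
proof -
  assume KL: "is_KL_family R P" and u: "u \<in> E"
  have P: "P u u = 1" using KL u by (auto simp: is_KL_family_def)
  have interval: "{t \<in> E. bruhat_le u t \<and> bruhat_le t u} = {u}"
    using u bruhat_antisym by auto
  have "q_pow (- L u) * q_pow (L u) * bar (P u u) =
      (\<Sum>t \<in> {t \<in> E. bruhat_le u t \<and> bruhat_le t u}. R u t * P t u)"
    using KL u unfolding is_KL_family_def by blast
  then have "bar (1 :: 'g group_ring) = R u u"
    by (simp add: P interval q_pow_mult q_pow_0)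
  moreover have "bar (1 :: 'g group_ring) = 1"
    by (rule poly_mapping_eqI) (auto simp: lookup_bar lookup_one)
  ultimately show ?thesis by simp
qed

text \<open>Unrolls the recursion once: \<open>N\<close> lengths on the right become
  \<open>Suc N\<close> on the left, the new term \<open>r = 0\<close> being the isolated coefficient
  of \<open>R u y\<close>. The case \<open>t = u\<close> is kept apart because there the length does
  not grow.\<close>

lemma KL_recursion_step:
  assumes KL: "is_KL_family R P" and u: "u \<in> E" and y: "y \<in> E" and le: "bruhat_le u y"
    and \<gamma>: "\<gamma> \<in> weight_group"
    and exponents: "\<And>t \<zeta>. t \<in> E \<Longrightarrow> bruhat_le u t \<Longrightarrow> Poly_Mapping.lookup (R u t) \<zeta> \<noteq> 0 \<Longrightarrow>
      \<zeta> \<in> weight_group \<and> \<zeta> \<le> L t - L u"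
    and same: "L y - L u - \<gamma> < \<gamma> \<Longrightarrow>
      Poly_Mapping.lookup (P u y) (L y - L u - \<gamma>) = (\<Sum>r<N. chain_sum E R y r u (L y - L u - \<gamma>))"
    and above: "\<And>t b. t \<in> E \<Longrightarrow> bruhat_less u t \<Longrightarrow> bruhat_le t y \<Longrightarrow> b \<in> weight_group \<Longrightarrow>
      L y - L t - b < b \<Longrightarrow>
      Poly_Mapping.lookup (P t y) (L y - L t - b) = (\<Sum>r<N. chain_sum E R y r t (L y - L t - b))"
  shows "Poly_Mapping.lookup (P u y) \<gamma> = (\<Sum>r<Suc N. chain_sum E R y r u \<gamma>)"
proof -
  let ?I = "{t \<in> E. bruhat_le u t \<and> bruhat_le t y}"
  let ?\<rho> = "\<lambda>t b. Poly_Mapping.lookup (R u t) (L t - L u - \<gamma> + b)"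
  let ?c = "\<lambda>t b. b \<le> \<gamma> \<and> L y - L t - b < b"
  have L_wg: "L w \<in> weight_group" if "w \<in> E" for w
    using that E_closed by (auto intro: weight_in_weight_group)
  have term_eq: "(?\<rho> t b * Poly_Mapping.lookup (P t y) (L y - L t - b) when ?c t b) =
      (\<Sum>r<N. ?\<rho> t b * chain_sum E R y r t (L y - L t - b) when ?c t b)"
    if t: "t \<in> ?I" for t b
  proof (cases "?\<rho> t b \<noteq> 0 \<and> ?c t b")
    case True
    \<comment> \<open>The sum lets \<open>b\<close> range over the whole group; its membership in
      \<open>weight_group\<close> is recovered from an exponent occurring in
      \<open>R u t\<close>.\<close>
    have "L t - L u - \<gamma> + b \<in> weight_group"
      using exponents [of t] t True by blast
    then have "(L t - L u - \<gamma> + b) - (L t - L u - \<gamma>) \<in> weight_group"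
      using L_wg t u \<gamma> by (intro weight_group_diff) auto
    then have b: "b \<in> weight_group" by simp
    have "Poly_Mapping.lookup (P t y) (L y - L t - b) = (\<Sum>r<N. chain_sum E R y r t (L y - L t - b))"
    proof (cases "t = u")
      case eq: True
      \<comment> \<open>\<open>R u u = 1\<close> has only the exponent 0, so
        \<open>L u - L u - \<gamma> + b\<close> must vanish.\<close>
      then have "b = \<gamma>"
        using True R_diag [OF KL u] by (auto simp: lookup_one when_def split: if_splits)
      then show ?thesis using same True eq by simp
    next
      case False
      then show ?thesis using above [of t b] t b True by (auto simp: bruhat_less_def)
    qed
    then show ?thesis using True by (simp add: sum_distrib_left)
  next
    case False
    then show ?thesis by auto
  qed
  have swap: "Sum_any (\<lambda>b. \<Sum>r<N. ?\<rho> t b * chain_sum E R y r t (L y - L t - b) when ?c t b) =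
      (\<Sum>r<N. Sum_any (\<lambda>b. ?\<rho> t b * chain_sum E R y r t (L y - L t - b) when ?c t b))" for t
  proof -
    let ?B = "{b. ?\<rho> t b \<noteq> 0}"
    have B: "finite ?B" by (rule finite_lookup_shift)
    have "Sum_any (\<lambda>b. \<Sum>r<N. ?\<rho> t b * chain_sum E R y r t (L y - L t - b) when ?c t b) =
        (\<Sum>b\<in>?B. \<Sum>r<N. ?\<rho> t b * chain_sum E R y r t (L y - L t - b) when ?c t b)"
      by (rule Sum_any.expand_superset [OF B])
        (auto elim!: sum.not_neutral_contains_not_neutral)
    also have "\<dots> = (\<Sum>r<N. \<Sum>b\<in>?B. ?\<rho> t b * chain_sum E R y r t (L y - L t - b) when ?c t b)"
      by (rule sum.swap)
    also have "\<dots> = (\<Sum>r<N. Sum_any (\<lambda>b. ?\<rho> t b * chain_sum E R y r t (L y - L t - b) when ?c t b))"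
      by (intro sum.cong refl Sum_any.expand_superset [OF B, symmetric]) (auto simp: when_def)
    finally show ?thesis .
  qed
  have "Poly_Mapping.lookup (P u y) \<gamma> = Poly_Mapping.lookup (R u y) (L y - L u - \<gamma>) +
      (\<Sum>t\<in>?I. Sum_any (\<lambda>b. ?\<rho> t b * Poly_Mapping.lookup (P t y) (L y - L t - b) when ?c t b))"
    using exponents by (intro KL_recursion [OF KL u y le]) blast
  also have "Poly_Mapping.lookup (R u y) (L y - L u - \<gamma>) = chain_sum E R y 0 u \<gamma>"
    using exponents [of y] y le by (intro chain_sum_0 [symmetric] E_closed u y le \<gamma>) blast
  also have "(\<Sum>t\<in>?I. Sum_any (\<lambda>b. ?\<rho> t b * Poly_Mapping.lookup (P t y) (L y - L t - b) when ?c t b)) =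
      (\<Sum>t\<in>?I. \<Sum>r<N. Sum_any (\<lambda>b. ?\<rho> t b * chain_sum E R y r t (L y - L t - b) when ?c t b))"
    by (rule sum.cong [OF refl]) (simp only: term_eq swap)
  also have "\<dots> = (\<Sum>r<N. chain_sum E R y (Suc r) u \<gamma>)"
    unfolding chain_sum_Suc [OF E_closed u y \<gamma>] by (rule sum.swap)
  also have "chain_sum E R y 0 u \<gamma> + \<dots> = (\<Sum>r<Suc N. chain_sum E R y r u \<gamma>)"
    by (rule sum.lessThan_Suc_shift [symmetric])
  finally show ?thesis .
qed

text \<open>In low degree the recursion never meets \<open>t = u\<close>, which would need
  \<open>L y - L u - \<gamma> < \<gamma>\<close>. So every step increases the length, and it stays
  in low degree. Steps may skip lengths, hence \<open>N\<close> is only bounded from below.\<close>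

lemma KL_chain_sum_low_degree:
  assumes KL: "is_KL_family R P" and y: "y \<in> E"
    and exponents: "\<And>u t \<zeta>. u \<in> E \<Longrightarrow> t \<in> E \<Longrightarrow> bruhat_le u t \<Longrightarrow>
      Poly_Mapping.lookup (R u t) \<zeta> \<noteq> 0 \<Longrightarrow> \<zeta> \<in> weight_group \<and> \<zeta> \<le> L t - L u"
    and "u \<in> E" "bruhat_le u y" "\<gamma> \<in> weight_group" "\<gamma> + \<gamma> < L y - L u" "len y \<le> N + len u"
  shows "Poly_Mapping.lookup (P u y) \<gamma> = (\<Sum>r<N. chain_sum E R y r u \<gamma>)"
  using assms(4-)
proof (induction N arbitrary: u \<gamma>)
  case 0
  \<comment> \<open>With no step left, \<open>u = y\<close>; the degree hypothesis makes
    \<open>\<gamma>\<close> negative, so the coefficient of \<open>P y y = 1\<close>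
    vanishes.\<close>
  then have "u = y"
    using bruhat_le_len [of u y] by auto
  moreover have "P y y = 1"
    using KL y by (auto simp: is_KL_family_def)
  ultimately show ?case
    using 0 by (auto simp: lookup_one when_def)
next
  case (Suc N)
  show ?case
  proof (rule KL_recursion_step [OF KL Suc.prems(1) y Suc.prems(2,3)])
    assume "L y - L u - \<gamma> < \<gamma>"
    then have False
      using Suc.prems(4) by (auto simp: algebra_simps)
    then show "Poly_Mapping.lookup (P u y) (L y - L u - \<gamma>) =
        (\<Sum>r<N. chain_sum E R y r u (L y - L u - \<gamma>))" ..
  next
    fix t b
    assume t: "t \<in> E" "bruhat_less u t" "bruhat_le t y" and b: "b \<in> weight_group" "L y - L t - b < b"
    have "len u < len t"
      using t(2) bruhat_le_len [of u t] by (auto simp: bruhat_less_def)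
    then show "Poly_Mapping.lookup (P t y) (L y - L t - b) =
        (\<Sum>r<N. chain_sum E R y r t (L y - L t - b))"
      using Suc.prems(5) t b y E_closed
      by (intro Suc.IH weight_group_diff weight_in_weight_group) (auto simp: algebra_simps)
  qed (use exponents Suc.prems(1) in auto)
qed

text \<open>One step from an arbitrary \<open>\<gamma>\<close> lands in low degree, since
  \<open>L y - L t - b < b\<close> puts twice the new parameter below \<open>L y - L t\<close>. This
  first step, possibly with \<open>t = u\<close>, accounts for the \<open>Suc\<close>.\<close>

lemma KL_chain_sum:
  assumes KL: "is_KL_family R P" and u: "u \<in> E" and y: "y \<in> E" and le: "bruhat_le u y"
    and \<gamma>: "\<gamma> \<in> weight_group"
    and exponents: "\<And>u t \<zeta>. u \<in> E \<Longrightarrow> t \<in> E \<Longrightarrow> bruhat_le u t \<Longrightarrow>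
      Poly_Mapping.lookup (R u t) \<zeta> \<noteq> 0 \<Longrightarrow> \<zeta> \<in> weight_group \<and> \<zeta> \<le> L t - L u"
  shows "Poly_Mapping.lookup (P u y) \<gamma> = (\<Sum>r<Suc (len y - len u). chain_sum E R y r u \<gamma>)"
proof (rule KL_recursion_step [OF KL u y le \<gamma>])
  have low: "Poly_Mapping.lookup (P t y) (L y - L t - b) =
      (\<Sum>r<len y - len u. chain_sum E R y r t (L y - L t - b))"
    if t: "t \<in> E" "bruhat_le u t" "bruhat_le t y" and b: "b \<in> weight_group" "L y - L t - b < b" for t b
  proof (rule KL_chain_sum_low_degree [OF KL y exponents t(1,3)])
    show "L y - L t - b \<in> weight_group"
      using t y b E_closed by (intro weight_group_diff weight_in_weight_group) auto
    show "L y - L t - b + (L y - L t - b) < L y - L t"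
      using b(2) by (simp add: algebra_simps)
    show "len y \<le> len y - len u + len t"
      using bruhat_le_len [OF t(2)] by auto
  qed
  show "Poly_Mapping.lookup (P u y) (L y - L u - \<gamma>) =
      (\<Sum>r<len y - len u. chain_sum E R y r u (L y - L u - \<gamma>))" if "L y - L u - \<gamma> < \<gamma>"
    using low [OF u _ le \<gamma> that] by simp
  fix t b
  assume "t \<in> E" "bruhat_less u t" "bruhat_le t y" "b \<in> weight_group" "L y - L t - b < b"
  then show "Poly_Mapping.lookup (P t y) (L y - L t - b) =
      (\<Sum>r<len y - len u. chain_sum E R y r t (L y - L t - b))"
    using low by (simp add: bruhat_less_def)
qed (use exponents u in auto)

end

theorem theorem6p3:
  fixes W :: "('w, 'b) monoid_scheme" and S :: "'w set"
    and L :: "'w \<Rightarrow> 'g::linordered_ab_group_add"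
    and scaleH :: "'g group_ring \<Rightarrow> 'h::ring_1 \<Rightarrow> 'h" and T :: "'w \<Rightarrow> 'h" and barH :: "'h \<Rightarrow> 'h"
    and scaleM :: "'g group_ring \<Rightarrow> 'm::ab_group_add \<Rightarrow> 'm" and E J :: "'w set"
    and act :: "'h \<Rightarrow> 'm \<Rightarrow> 'm" and Gam :: "'w \<Rightarrow> 'm" and barM :: "'m \<Rightarrow> 'm"
    and R P :: "'w \<Rightarrow> 'w \<Rightarrow> 'g group_ring"
    and x y :: 'w and \<gamma> :: 'g
  assumes ideal: "w_graph_ideal W S L scaleH T barH scaleM E J act Gam barM"
    and R_family: "w_graph_ideal.is_R_family W S L scaleM E Gam barM R"
    and R_exponents: "\<And>u v \<zeta>. u \<in> E \<Longrightarrow> v \<in> E \<Longrightarrow> coxeter_system.bruhat_le W S u v \<Longrightarrow>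
      Poly_Mapping.lookup (R u v) \<zeta> \<noteq> 0 \<Longrightarrow>
      \<zeta> \<in> weighted_coxeter_system.weight_group S L \<and> 0 \<le> \<zeta> \<and> \<zeta> \<le> L v - L u"
    and KL_family: "w_graph_ideal.is_KL_family W S L E R P"
    and "x \<in> E" and "y \<in> E"
    and "\<gamma> \<in> weighted_coxeter_system.weight_group S L"
  shows "Poly_Mapping.lookup (P x y) \<gamma> =
    Poly_Mapping.lookup (R x y) (- L x + L y - \<gamma>) +
    (\<Sum>r = 1..coxeter_system.len W S y - coxeter_system.len W S x.
      \<Sum>xs \<in> coxeter_system.multichains W S E r x y.
        Sum_any (\<lambda>a.
          (\<Prod>i \<le> r. Poly_Mapping.lookup (R (xs ! i) (xs ! (i + 1)))
             (L (xs ! (i + 1)) - L y + a ! i + a ! (i + 1)))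
          when a \<in> weighted_coxeter_system.index_set S L \<gamma> r xs))"
proof -
  interpret w_graph_ideal W S L scaleH T barH scaleM E J act Gam barM
    by (rule ideal)
  have exponents: "\<zeta> \<in> weight_group \<and> \<zeta> \<le> L v - L u"
    if "u \<in> E" "v \<in> E" "bruhat_le u v" "Poly_Mapping.lookup (R u v) \<zeta> \<noteq> 0" for u v \<zeta>
    using R_exponents that by blast
  have rhs: "(\<Sum>r = 1..len y - len x. \<Sum>xs \<in> multichains E r x y.
      Sum_any (\<lambda>a. (\<Prod>i \<le> r. Poly_Mapping.lookup (R (xs ! i) (xs ! (i + 1)))
           (L (xs ! (i + 1)) - L y + a ! i + a ! (i + 1)))
        when a \<in> index_set \<gamma> r xs)) = (\<Sum>r = 1..len y - len x. chain_sum E R y r x \<gamma>)"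
    by (simp add: chain_sum_def chain_term_def)
  have coeff: "- L x + L y - \<gamma> = L y - L x - \<gamma>"
    by simp
  show ?thesis
    unfolding rhs coeff
  proof (cases "bruhat_le x y")
    case True
    have "Poly_Mapping.lookup (P x y) \<gamma> = (\<Sum>r<Suc (len y - len x). chain_sum E R y r x \<gamma>)"
      by (rule KL_chain_sum [OF KL_family \<open>x \<in> E\<close> \<open>y \<in> E\<close> True assms(7) exponents])
    also have "\<dots> = chain_sum E R y 0 x \<gamma> + (\<Sum>r = 1..len y - len x. chain_sum E R y r x \<gamma>)"
      by (simp only: sum.lessThan_Suc_shift sum.atLeast1_atMost_eq One_nat_def)
    also have "chain_sum E R y 0 x \<gamma> = Poly_Mapping.lookup (R x y) (L y - L x - \<gamma>)"
      using exponents assms(5,6) True by (intro chain_sum_0 E_closed assms(5-7) True) blast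
    finally show "Poly_Mapping.lookup (P x y) \<gamma> = Poly_Mapping.lookup (R x y) (L y - L x - \<gamma>) +
      (\<Sum>r = 1..len y - len x. chain_sum E R y r x \<gamma>)" .
  next
    case False
    \<comment> \<open>Without \<open>x \<le> y\<close> there are no multichains, and
      \<open>R x y = 0\<close> comes from triangularity, as \<open>R_exponents\<close> speaks only
      of comparable pairs.\<close>
    then have "P x y = 0"
      using KL_family \<open>x \<in> E\<close> \<open>y \<in> E\<close> by (auto simp: is_KL_family_def)
    moreover have "R x y = 0"
      by (rule R_family_eq_0 [OF R_family \<open>x \<in> E\<close> \<open>y \<in> E\<close> False])
    moreover have "multichains E r x y = {}" for r
      using False multichains_le by blast
    ultimately show "Poly_Mapping.lookup (P x y) \<gamma> = Poly_Mapping.lookup (R x y) (L y - L x - \<gamma>) +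
      (\<Sum>r = 1..len y - len x. chain_sum E R y r x \<gamma>)"
      by (simp add: chain_sum_def)
  qed
qed

end
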